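(* Let $M$ be a finite-dimensional manifold with a formal deformation, to lowest order in $\hbar$, of its differential calculus (see context) whose Poisson bracket is nondegenerate (symplectic). Let $\nabla$ be the associated connection and $\omega=\omega_{ij}\,\mathrm{d}x^i\wedge\mathrm{d}x^j$ the symplectic form. Then $\omega$ commutes in the $\bullet$ product with all functions to $O(\hbar^2)$ (i.e. $x\bullet\omega-\omega\bullet x=O(\hbar^2)$ for all $x\in C^\infty(M)$) if and only if $\nabla$ preserves $\omega$ (i.e. $\nabla\omega=0$) and $\nabla$ is torsion free.
   Context: $\Omega^n(M)$ denotes the $n$-forms on $M$, $\Omega^0(M)=C^\infty(M)$. A formal deformation of the differential calculus on $M$ to lowest order in $\hbar$ consists of the following maps depending on a parameter $\hbar$ and admitting power series expansions in $\hbar$ (extended linearly in $\hbar$; $O(\hbar^k)$ denotes terms of order at least $k$ in $\hbar$): (i) an associative product $\bullet$ on $C^\infty(M)$ with $x\bullet y=xy+O(\hbar)$ and $x\bullet y-y\bullet x=\hbar\{x,y\}+O(\hbar^2)$ (so $\{\ ,\ \}$ is a Poisson bracket); (ii) products $x\bullet\tau$ and $\tau\bullet x$ for $x\in C^\infty(M)$, $\tau\in\Omega^1(M)$, both equal to $x\tau+O(\hbar)$, making $\Omega^1(M)$ a bimodule to order $O(\hbar^2)$: $(x\bullet y)\bullet\tau-x\bullet(y\bullet\tau)=O(\hbar^2)$, $\tau\bullet(x\bullet y)-(\tau\bullet x)\bullet y=O(\hbar^2)$, $(x\bullet\tau)\bullet y-x\bullet(\tau\bullet y)=O(\hbar^2)$;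 (iii) a deformed exterior product $\wedge_\bullet$ on forms, with $\tau\wedge_\bullet\eta=\tau\wedge\eta+O(\hbar)$, associative to $O(\hbar^2)$ (written $\bullet$ when one of the factors is a function); (iv) an operator $\mathrm{d}^\bullet:\Omega^n(M)\to\Omega^{n+1}(M)$ with $\mathrm{d}^\bullet=\mathrm{d}+O(\hbar)$ which is a graded derivation to order $O(\hbar^2)$: $\mathrm{d}^\bullet(\xi\wedge_\bullet\eta)=\mathrm{d}^\bullet\xi\wedge_\bullet\eta+(-1)^{\deg\xi}\xi\wedge_\bullet\mathrm{d}^\bullet\eta+O(\hbar^2)$. The map $\gamma$ is defined by $x\bullet\tau-\tau\bullet x=\hbar\gamma(x,\tau)+O(\hbar^2)$; it satisfies $\gamma(xy,\tau)=x\gamma(y,\tau)+\gamma(x,\tau)y$, $\gamma(x,\tau y)=\gamma(x,\tau)y+\tau\{x,y\}$ and $\mathrm{d}\{x,y\}=\gamma(x,\mathrm{d}y)-\gamma(y,\mathrm{d}x)$. In local coordinates $\{y,z\}=\omega^{ij}\frac{\partial y}{\partial x^i}\frac{\partial z}{\partial x^j}$; in the nondegenerate case $(\omega_{ij})$ is the inverse matrix, $\omega^{ij}\omega_{jk}=\delta^i_k$. In this case there is a unique covariant connection $\nabla$ on $1$-forms (extended to all tensors in the usual way) such that $\gamma(y,\tau)=\nabla_{\hat y}\tau=\omega^{kq}\frac{\partial y}{\partial x^k}\nabla_q\tau$, where $\hat y=\{y,-\}$; this is the associated connection. Torsion is $T(U,V)=\nabla_UV-\nabla_VU-[U,V]$.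 *)

theory Defs
  imports
    "HOL-Analysis.Analysis"
    "HOL-Library.Function_Algebras"
    "HOL-Computational_Algebra.Formal_Power_Series"
begin

section \<open>Smooth manifolds\<close>

text \<open>
  A manifold is a Hausdorff, second countable type \<open>'a\<close> together with a smooth atlas
  (not necessarily maximal) of charts \<open>(U, \<phi>)\<close> with values in \<open>real^'n\<close>.
\<close>

type_synonym ('a, 'n) chart = "'a set \<times> ('a \<Rightarrow> real ^ 'n)"

abbreviation chart_inv :: "('a, 'n) chart \<Rightarrow> real ^ 'n \<Rightarrow> 'a"
  where "chart_inv c \<equiv> inv_into (fst c) (snd c)"

text \<open>Only used for open sets \<open>S\<close>.\<close>

primrec Ck_on ::
  "nat \<Rightarrow> 'a::real_normed_vector set \<Rightarrow> ('a \<Rightarrow> 'b::real_normed_vector) \<Rightarrow> bool"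
where
  "Ck_on 0 S f \<longleftrightarrow> continuous_on S f"
| "Ck_on (Suc k) S f \<longleftrightarrow>
     f differentiable_on S \<and> (\<forall>v. Ck_on k S (\<lambda>x. frechet_derivative f (at x) v))"

definition smooth_on ::
  "'a::real_normed_vector set \<Rightarrow> ('a \<Rightarrow> 'b::real_normed_vector) \<Rightarrow> bool"
  where "smooth_on S f \<longleftrightarrow> (\<forall>k. Ck_on k S f)"

definition smooth_atlas ::
  "('a::{t2_space, second_countable_topology}, 'n::finite) chart set \<Rightarrow> bool"
where
  "smooth_atlas A \<longleftrightarrow>
     (\<Union>c\<in>A. fst c) = UNIV \<and>
     (\<forall>c\<in>A. open (fst c) \<and> open (snd c ` fst c) \<and>
        homeomorphism (fst c) (snd c ` fst c) (snd c) (chart_inv c)) \<and>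
     (\<forall>c\<in>A. \<forall>c'\<in>A. smooth_on (snd c ` (fst c \<inter> fst c')) (snd c' \<circ> chart_inv c))"

definition Cinf :: "('a, 'n::finite) chart set \<Rightarrow> ('a \<Rightarrow> real) set"
  where "Cinf A = {f. \<forall>c\<in>A. smooth_on (snd c ` fst c) (f \<circ> chart_inv c)}"


section \<open>Tangent vectors and vector fields\<close>

text \<open>
  Tangent vectors at \<open>p\<close> are the directional derivative operators on smooth functions; they are
  extended by \<open>0\<close> to non-smooth functions so that two of them are equal as HOL functions
  iff they agree on smooth functions.
  \<open>tvec A c p a\<close> is \<open>\<Sum>i. a\<^sup>i \<partial>/\<partial>x\<^sup>i\<close> at \<open>p\<close> in the coordinates of the chart \<open>c\<close>.
\<close>

type_synonym 'a tvec = "('a \<Rightarrow> real) \<Rightarrow> real"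

definition tvec :: "('a, 'n::finite) chart set \<Rightarrow> ('a, 'n) chart \<Rightarrow> 'a \<Rightarrow> real ^ 'n \<Rightarrow> 'a tvec"
where
  "tvec A c p a = (\<lambda>f. if f \<in> Cinf A
     then frechet_derivative (f \<circ> chart_inv c) (at (snd c p)) a else 0)"

definition tangent :: "('a, 'n::finite) chart set \<Rightarrow> 'a \<Rightarrow> 'a tvec set"
  where "tangent A p = {tvec A c p a | c a. c \<in> A \<and> p \<in> fst c}"

definition partial :: "('a, 'n::finite) chart set \<Rightarrow> ('a, 'n) chart \<Rightarrow> 'n \<Rightarrow> 'a \<Rightarrow> 'a tvec"
  where "partial A c i p = tvec A c p (axis i 1)"

definition coords ::
  "('a, 'n::finite) chart set \<Rightarrow> ('a, 'n) chart \<Rightarrow> 'a \<Rightarrow> 'a tvec \<Rightarrow> real ^ 'n"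
  where "coords A c p v = (THE a. v = tvec A c p a)"

type_synonym 'a vfield = "'a \<Rightarrow> 'a tvec"

definition vfields :: "('a, 'n::finite) chart set \<Rightarrow> 'a vfield set"
where
  "vfields A = {V. (\<forall>p. V p \<in> tangent A p) \<and>
     (\<forall>c\<in>A. \<exists>a. smooth_on (snd c ` fst c) a \<and> (\<forall>p\<in>fst c. V p = tvec A c p (a (snd c p))))}"

abbreviation apply_vf :: "'a vfield \<Rightarrow> ('a \<Rightarrow> real) \<Rightarrow> 'a \<Rightarrow> real"
  where "apply_vf V f \<equiv> (\<lambda>p. V p f)"

definition smul_vf :: "('a \<Rightarrow> real) \<Rightarrow> 'a vfield \<Rightarrow> 'a vfield"
  where "smul_vf f V = (\<lambda>p g. f p * V p g)"

definition lie_bracket :: "'a vfield \<Rightarrow> 'a vfield \<Rightarrow> 'a vfield"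
  where "lie_bracket U V = (\<lambda>p f. U p (apply_vf V f) - V p (apply_vf U f))"


section \<open>Differential forms\<close>

text \<open>
  A form is evaluated at a point on a list of tangent vectors; an \<open>n\<close>-form is extended
  by \<open>0\<close> to lists which do not consist of \<open>n\<close> tangent vectors at the point. In this way
  forms of all degrees live in one type and equality of forms is equality of HOL functions.
\<close>

type_synonym 'a form = "'a \<Rightarrow> 'a tvec list \<Rightarrow> real"

definition forms :: "('a, 'n::finite) chart set \<Rightarrow> nat \<Rightarrow> 'a form set"
where
  "forms A n = {\<alpha>.
     (\<forall>p vs. \<not> (length vs = n \<and> set vs \<subseteq> tangent A p) \<longrightarrow> \<alpha> p vs = 0) \<and>
     (\<forall>p vs i v w. length vs = n \<and> set vs \<subseteq> tangent A p \<and> i < n \<and>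
        v \<in> tangent A p \<and> w \<in> tangent A p \<longrightarrow>
        \<alpha> p (vs[i := v + w]) = \<alpha> p (vs[i := v]) + \<alpha> p (vs[i := w])) \<and>
     (\<forall>p vs i v r. length vs = n \<and> set vs \<subseteq> tangent A p \<and> i < n \<and> v \<in> tangent A p \<longrightarrow>
        \<alpha> p (vs[i := (\<lambda>f. r * v f)]) = r * \<alpha> p (vs[i := v])) \<and>
     (\<forall>p vs i j. length vs = n \<and> set vs \<subseteq> tangent A p \<and> i < j \<and> j < n \<and> vs ! i = vs ! j \<longrightarrow>
        \<alpha> p vs = 0) \<and>
     (\<forall>c\<in>A. \<forall>is. length is = n \<longrightarrow>
        smooth_on (snd c ` fst c)
          ((\<lambda>p. \<alpha> p (map (\<lambda>i. partial A c i p) is)) \<circ> chart_inv c))}"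

text \<open>Identification of functions with \<open>0\<close>-forms.\<close>

definition fn :: "('a \<Rightarrow> real) \<Rightarrow> 'a form"
  where "fn f = (\<lambda>p vs. if vs = [] then f p else 0)"

definition smul :: "('a \<Rightarrow> real) \<Rightarrow> 'a form \<Rightarrow> 'a form"
  where "smul f \<alpha> = (\<lambda>p vs. f p * \<alpha> p vs)"

text \<open>
  The wedge product as a sum over shuffles: the vectors with positions in \<open>S\<close> go, in order,
  into \<open>\<alpha>\<close>, the others into \<open>\<beta>\<close>, with the sign of that permutation. No degrees are needed since
  \<open>\<alpha>\<close> and \<open>\<beta>\<close> vanish on lists of the wrong length. The normalisation is
  \<open>\<tau> \<and> \<eta> = \<tau> \<otimes> \<eta> - \<eta> \<otimes> \<tau>\<close> on \<open>1\<close>-forms.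
\<close>

definition wedge :: "'a form \<Rightarrow> 'a form \<Rightarrow> 'a form"
where
  "wedge \<alpha> \<beta> = (\<lambda>p vs. \<Sum>S\<in>Pow {..<length vs}.
     (-1) ^ card {(i, j). i \<in> S \<and> j < i \<and> j \<notin> S} * \<alpha> p (nths vs S) * \<beta> p (nths vs (- S)))"

text \<open>
  The exterior derivative
  \<open>d\<alpha>(v\<^sub>0, \<dots>, v\<^sub>k) = \<Sum>j. (-1)\<^sup>j v\<^sub>j (\<alpha>(V\<^sub>0, \<dots>, omit V\<^sub>j, \<dots>, V\<^sub>k))\<close>, where \<open>V\<^sub>i\<close> extends \<open>v\<^sub>i\<close> with constant
  coefficients in a chart around the point; for smooth forms the choice of the chart is irrelevant.
\<close>

definition ext_d :: "('a, 'n::finite) chart set \<Rightarrow> 'a form \<Rightarrow> 'a form"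
where
  "ext_d A \<alpha> = (\<lambda>p vs. if set vs \<subseteq> tangent A p then
     (let c = (SOME c. c \<in> A \<and> p \<in> fst c); as = map (coords A c p) vs in
       \<Sum>j<length vs. (-1) ^ j *
         frechet_derivative
           (\<lambda>z. \<alpha> (chart_inv c z)
              (map (tvec A c (chart_inv c z)) (take j as @ drop (Suc j) as)))
           (at (snd c p)) (as ! j))
     else 0)"

definition dx :: "('a, 'n::finite) chart set \<Rightarrow> ('a, 'n) chart \<Rightarrow> 'n \<Rightarrow> 'a form"
where
  "dx A c i = (\<lambda>p vs. case vs of
     [v] \<Rightarrow> if p \<in> fst c \<and> v \<in> tangent A p then coords A c p v $ i else 0
   | _ \<Rightarrow> 0)"


section \<open>Formal power series in the deformation parameter\<close>

text \<open>A quantity depending formally on \<open>\<hbar>\<close> is an \<open>fps\<close>; \<open>bigO_h k F\<close> is \<open>F = O(\<hbar>\<^sup>k)\<close>.\<close>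

definition bigO_h :: "nat \<Rightarrow> 'b::zero fps \<Rightarrow> bool"
  where "bigO_h k F \<longleftrightarrow> (\<forall>i<k. fps_nth F i = 0)"

definition hscale :: "real \<Rightarrow> 'a form fps \<Rightarrow> 'a form fps"
  where "hscale r F = Abs_fps (\<lambda>n. smul (\<lambda>_. r) (fps_nth F n))"

text \<open>\<open>\<hbar>\<close>-bilinear and \<open>\<hbar>\<close>-linear extension of operations on forms with values in series.\<close>

definition hprod ::
  "('a form \<Rightarrow> 'a form \<Rightarrow> 'a form fps) \<Rightarrow> 'a form fps \<Rightarrow> 'a form fps \<Rightarrow> 'a form fps"
where
  "hprod P F G = Abs_fps (\<lambda>n. \<Sum>i\<le>n. \<Sum>j\<le>n - i.
     fps_nth (P (fps_nth F i) (fps_nth G j)) (n - i - j))"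

definition hmap :: "('a form \<Rightarrow> 'a form fps) \<Rightarrow> 'a form fps \<Rightarrow> 'a form fps"
  where "hmap D F = Abs_fps (\<lambda>n. \<Sum>i\<le>n. fps_nth (D (fps_nth F i)) (n - i))"


section \<open>Formal deformations of the differential calculus\<close>

text \<open>
  \<open>P \<alpha> \<beta>\<close> is \<open>\<alpha> \<and>\<^sub>\<bullet> \<beta>\<close>, which is \<open>\<alpha> \<bullet> \<beta>\<close> if one factor is a function, and \<open>D\<close> is the deformed
  exterior derivative. The three bimodule identities for \<open>1\<close>-forms are \<open>wedge_assoc\<close> in the degrees
  \<open>(0,0,1)\<close>, \<open>(1,0,0)\<close>, \<open>(0,1,0)\<close>. Associativity on functions holds to all orders in \<open>\<hbar>\<close>, the other
  identities only up to \<open>O(\<hbar>\<^sup>2)\<close>.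
\<close>

locale formal_deformation =
  fixes A :: "('a::{t2_space, second_countable_topology}, 'n::finite) chart set"
    and P :: "'a form \<Rightarrow> 'a form \<Rightarrow> 'a form fps"
    and D :: "'a form \<Rightarrow> 'a form fps"
  assumes prod_forms: "\<lbrakk>\<alpha> \<in> forms A m; \<beta> \<in> forms A n\<rbrakk> \<Longrightarrow> fps_nth (P \<alpha> \<beta>) k \<in> forms A (m + n)"
    and prod_add_left: "\<lbrakk>\<alpha> \<in> forms A m; \<alpha>' \<in> forms A m; \<beta> \<in> forms A n\<rbrakk> \<Longrightarrow>
          P (\<alpha> + \<alpha>') \<beta> = P \<alpha> \<beta> + P \<alpha>' \<beta>"
    and prod_add_right: "\<lbrakk>\<alpha> \<in> forms A m; \<beta> \<in> forms A n; \<beta>' \<in> forms A n\<rbrakk> \<Longrightarrow>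
          P \<alpha> (\<beta> + \<beta>') = P \<alpha> \<beta> + P \<alpha> \<beta>'"
    and prod_scale_left: "\<lbrakk>\<alpha> \<in> forms A m; \<beta> \<in> forms A n\<rbrakk> \<Longrightarrow>
          P (smul (\<lambda>_. r) \<alpha>) \<beta> = hscale r (P \<alpha> \<beta>)"
    and prod_scale_right: "\<lbrakk>\<alpha> \<in> forms A m; \<beta> \<in> forms A n\<rbrakk> \<Longrightarrow>
          P \<alpha> (smul (\<lambda>_. r) \<beta>) = hscale r (P \<alpha> \<beta>)"
    and prod_classical: "\<lbrakk>\<alpha> \<in> forms A m; \<beta> \<in> forms A n\<rbrakk> \<Longrightarrow>
          bigO_h 1 (P \<alpha> \<beta> - fps_const (wedge \<alpha> \<beta>))"
    and fun_assoc: "\<lbrakk>x \<in> forms A 0; y \<in> forms A 0; z \<in> forms A 0\<rbrakk> \<Longrightarrow>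
          hprod P (P x y) (fps_const z) = hprod P (fps_const x) (P y z)"
    and wedge_assoc: "\<lbrakk>\<alpha> \<in> forms A l; \<beta> \<in> forms A m; \<gamma> \<in> forms A n\<rbrakk> \<Longrightarrow>
          bigO_h 2 (hprod P (P \<alpha> \<beta>) (fps_const \<gamma>) - hprod P (fps_const \<alpha>) (P \<beta> \<gamma>))"
    and d_forms: "\<alpha> \<in> forms A n \<Longrightarrow> fps_nth (D \<alpha>) k \<in> forms A (Suc n)"
    and d_add: "\<lbrakk>\<alpha> \<in> forms A n; \<beta> \<in> forms A n\<rbrakk> \<Longrightarrow> D (\<alpha> + \<beta>) = D \<alpha> + D \<beta>"
    and d_scale: "\<alpha> \<in> forms A n \<Longrightarrow> D (smul (\<lambda>_. r) \<alpha>) = hscale r (D \<alpha>)"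
    and d_classical: "\<alpha> \<in> forms A n \<Longrightarrow> bigO_h 1 (D \<alpha> - fps_const (ext_d A \<alpha>))"
    and d_leibniz: "\<lbrakk>\<alpha> \<in> forms A m; \<beta> \<in> forms A n\<rbrakk> \<Longrightarrow>
          bigO_h 2 (hmap D (P \<alpha> \<beta>) -
            (hprod P (D \<alpha>) (fps_const \<beta>) + hscale ((-1) ^ m) (hprod P (fps_const \<alpha>) (D \<beta>))))"

definition poisson ::
  "('a form \<Rightarrow> 'a form \<Rightarrow> 'a form fps) \<Rightarrow> ('a \<Rightarrow> real) \<Rightarrow> ('a \<Rightarrow> real) \<Rightarrow> 'a \<Rightarrow> real"
  where "poisson P x y = (\<lambda>p. fps_nth (P (fn x) (fn y) - P (fn y) (fn x)) 1 p [])"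

definition gam :: "('a form \<Rightarrow> 'a form \<Rightarrow> 'a form fps) \<Rightarrow> ('a \<Rightarrow> real) \<Rightarrow> 'a form \<Rightarrow> 'a form"
  where "gam P x \<tau> = fps_nth (P (fn x) \<tau> - P \<tau> (fn x)) 1"

text \<open>\<open>M\<close> is the matrix \<open>\<omega>\<^sup>i\<^sup>j\<close> of the bracket at \<open>p\<close> in the coordinates of \<open>c\<close>.\<close>

definition poisson_matrix_at ::
  "('a, 'n::finite) chart set \<Rightarrow> ('a form \<Rightarrow> 'a form \<Rightarrow> 'a form fps) \<Rightarrow>
     ('a, 'n) chart \<Rightarrow> 'a \<Rightarrow> real ^ 'n ^ 'n \<Rightarrow> bool"
where
  "poisson_matrix_at A P c p M \<longleftrightarrow>
     (\<forall>y\<in>Cinf A. \<forall>z\<in>Cinf A.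
        poisson P y z p = (\<Sum>i\<in>UNIV. \<Sum>j\<in>UNIV. M $ i $ j * partial A c i p y * partial A c j p z))"

definition nondegenerate_poisson ::
  "('a, 'n::finite) chart set \<Rightarrow> ('a form \<Rightarrow> 'a form \<Rightarrow> 'a form fps) \<Rightarrow> bool"
where
  "nondegenerate_poisson A P \<longleftrightarrow>
     (\<forall>c\<in>A. \<forall>p\<in>fst c. \<exists>M. poisson_matrix_at A P c p M \<and> invertible M)"

text \<open>\<open>\<omega> = \<omega>\<^sub>i\<^sub>j dx\<^sup>i \<and> dx\<^sup>j\<close> (sum over all \<open>i\<close>, \<open>j\<close>) with \<open>(\<omega>\<^sub>i\<^sub>j)\<close> the inverse of \<open>(\<omega>\<^sup>i\<^sup>j)\<close>.\<close>

definition symplectic_form ::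
  "('a, 'n::finite) chart set \<Rightarrow> ('a form \<Rightarrow> 'a form \<Rightarrow> 'a form fps) \<Rightarrow> 'a form \<Rightarrow> bool"
where
  "symplectic_form A P \<omega> \<longleftrightarrow> \<omega> \<in> forms A 2 \<and>
     (\<forall>c\<in>A. \<forall>p\<in>fst c. \<forall>M. poisson_matrix_at A P c p M \<longrightarrow>
        \<omega> p = (\<Sum>i\<in>UNIV. \<Sum>j\<in>UNIV.
          smul (\<lambda>_. matrix_inv M $ i $ j) (wedge (dx A c i) (dx A c j)) p))"


section \<open>Connections\<close>

locale covariant_connection =
  fixes A :: "('a::{t2_space, second_countable_topology}, 'n::finite) chart set"
    and nabla :: "'a vfield \<Rightarrow> 'a form \<Rightarrow> 'a form"
  assumes form: "\<lbrakk>U \<in> vfields A; \<tau> \<in> forms A 1\<rbrakk> \<Longrightarrow> nabla U \<tau> \<in> forms A 1"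
    and add_vf: "\<lbrakk>U \<in> vfields A; V \<in> vfields A; \<tau> \<in> forms A 1\<rbrakk> \<Longrightarrow>
          nabla (U + V) \<tau> = nabla U \<tau> + nabla V \<tau>"
    and smul_vf: "\<lbrakk>f \<in> Cinf A; U \<in> vfields A; \<tau> \<in> forms A 1\<rbrakk> \<Longrightarrow>
          nabla (smul_vf f U) \<tau> = smul f (nabla U \<tau>)"
    and add_form: "\<lbrakk>U \<in> vfields A; \<tau> \<in> forms A 1; \<eta> \<in> forms A 1\<rbrakk> \<Longrightarrow>
          nabla U (\<tau> + \<eta>) = nabla U \<tau> + nabla U \<eta>"
    and leibniz: "\<lbrakk>f \<in> Cinf A; U \<in> vfields A; \<tau> \<in> forms A 1\<rbrakk> \<Longrightarrow>
          nabla U (smul f \<tau>) = smul (apply_vf U f) \<tau> + smul f (nabla U \<tau>)"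

text \<open>The vector field \<open>\<hat>y = {y, -}\<close>.\<close>

definition ham_field ::
  "('a, 'n::finite) chart set \<Rightarrow> ('a form \<Rightarrow> 'a form \<Rightarrow> 'a form fps) \<Rightarrow> ('a \<Rightarrow> real) \<Rightarrow> 'a vfield"
  where "ham_field A P y = (\<lambda>p f. if f \<in> Cinf A then poisson P y f p else 0)"

definition associated_connection ::
  "('a::{t2_space, second_countable_topology}, 'n::finite) chart set \<Rightarrow>
     ('a form \<Rightarrow> 'a form \<Rightarrow> 'a form fps) \<Rightarrow> ('a vfield \<Rightarrow> 'a form \<Rightarrow> 'a form) \<Rightarrow> bool"
where
  "associated_connection A P nabla \<longleftrightarrow> covariant_connection A nabla \<and>
     (\<forall>y\<in>Cinf A. \<forall>\<tau>\<in>forms A 1. gam P y \<tau> = nabla (ham_field A P y) \<tau>)"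

text \<open>
  The connection on vector fields is the dual one, \<open>\<tau>(\<nabla>\<^sub>U V) = U(\<tau>(V)) - (\<nabla>\<^sub>U \<tau>)(V)\<close>. Taking
  \<open>\<tau> = df\<close> this gives the value of the tangent vector \<open>\<nabla>\<^sub>U V\<close> on \<open>f\<close>.
\<close>

definition nabla_vf ::
  "('a, 'n::finite) chart set \<Rightarrow> ('a vfield \<Rightarrow> 'a form \<Rightarrow> 'a form) \<Rightarrow>
     'a vfield \<Rightarrow> 'a vfield \<Rightarrow> 'a vfield"
where
  "nabla_vf A nabla U V = (\<lambda>p f. if f \<in> Cinf A
     then U p (apply_vf V f) - nabla U (ext_d A (fn f)) p [V p] else 0)"

definition torsion ::
  "('a, 'n::finite) chart set \<Rightarrow> ('a vfield \<Rightarrow> 'a form \<Rightarrow> 'a form) \<Rightarrow>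
     'a vfield \<Rightarrow> 'a vfield \<Rightarrow> 'a vfield"
  where "torsion A nabla U V = nabla_vf A nabla U V - nabla_vf A nabla V U - lie_bracket U V"

definition torsion_free ::
  "('a, 'n::finite) chart set \<Rightarrow> ('a vfield \<Rightarrow> 'a form \<Rightarrow> 'a form) \<Rightarrow> bool"
  where "torsion_free A nabla \<longleftrightarrow> (\<forall>U\<in>vfields A. \<forall>V\<in>vfields A. torsion A nabla U V = 0)"

text \<open>The function \<open>(\<nabla>\<^sub>U \<alpha>)(V, W)\<close> for a \<open>2\<close>-form \<open>\<alpha>\<close>.\<close>

definition nabla_2form ::
  "('a, 'n::finite) chart set \<Rightarrow> ('a vfield \<Rightarrow> 'a form \<Rightarrow> 'a form) \<Rightarrow>
     'a vfield \<Rightarrow> 'a form \<Rightarrow> 'a vfield \<Rightarrow> 'a vfield \<Rightarrow> 'a \<Rightarrow> real"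
where
  "nabla_2form A nabla U \<alpha> V W = (\<lambda>p.
     U p (\<lambda>q. \<alpha> q [V q, W q])
     - \<alpha> p [nabla_vf A nabla U V p, W p] - \<alpha> p [V p, nabla_vf A nabla U W p])"

definition preserves_2form ::
  "('a, 'n::finite) chart set \<Rightarrow> ('a vfield \<Rightarrow> 'a form \<Rightarrow> 'a form) \<Rightarrow> 'a form \<Rightarrow> bool"
where
  "preserves_2form A nabla \<alpha> \<longleftrightarrow>
     (\<forall>U\<in>vfields A. \<forall>V\<in>vfields A. \<forall>W\<in>vfields A. nabla_2form A nabla U \<alpha> V W = 0)"

end

theory Submission
  imports Defs
begin

text \<open>
  Let \<open>gam P x \<alpha>\<close> be the coefficient of \<open>\<hbar>\<close> in \<open>x \<bullet> \<alpha> - \<alpha> \<bullet> x\<close>. Functions and forms commute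
  classically, so \<open>\<omega>\<close> is central up to \<open>O(\<hbar>\<^sup>2)\<close> iff \<open>gam P x \<omega> = 0\<close> for all \<open>x\<close>
  (\<open>commutator_bigO\<close>). The statement then splits into two equivalences.

  The first is that \<open>gam P x \<omega> = 0\<close> for all \<open>x\<close> iff \<open>\<nabla>\<omega> = 0\<close> (\<open>preserves_iff_gam\<close>). Associativity to
  first order makes \<open>gam P x\<close> a derivation of the wedge product (\<open>gam_wedge\<close>), and so is the
  covariant derivative along the Hamiltonian field \<open>ham x = {x, -}\<close>. They agree on functions and, by the
  definition of the associated connection, on \<open>1\<close>-forms. Since a \<open>2\<close>-form is locally a sum of wedge
  products of \<open>1\<close>-forms, they agree on \<open>2\<close>-forms (\<open>gam_nabla_2form\<close>). By nondegeneracy every tangent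
  vector is the value of a Hamiltonian field (\<open>ham_surj\<close>), and \<open>\<nabla>\<^sub>U\<close> at a point depends on the
  value of \<open>U\<close> there only (\<open>nabla_pointwise\<close>), so Hamiltonian directions suffice.

  The second is that \<open>\<nabla>\<omega> = 0\<close> iff \<open>\<nabla>\<close> is torsion free. Put \<open>hess x y z = (\<nabla>\<^bsub>ham x\<^esub> dy)(ham z)\<close>. The
  Leibniz rule for the deformed differential gives \<open>d{x,y} = \<nabla>\<^bsub>ham x\<^esub> dy - \<nabla>\<^bsub>ham y\<^esub> dx\<close> at first order, that
  is \<open>{z,{x,y}} = hess x y z - hess y x z\<close> (\<open>d_poisson\<close>, \<open>hess_antisym\<close>), and dually
  \<open>T(ham x,ham y) z = hess y z x - hess x z y\<close>. From \<open>\<omega>(ham y, v) = 2 v(y)\<close> (\<open>omega_ham\<close>) one computes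
  \<open>(\<nabla>\<^bsub>ham x\<^esub> \<omega>)(ham y,ham z) = 2 ({x,{y,z}} + hess x y z - hess x z y)\<close>, which equals
  \<open>2 (T(ham x,ham y) z - T(ham x,ham z) y)\<close>
  (\<open>nabla_omega_torsion\<close>). So vanishing torsion gives \<open>\<nabla>\<omega> = 0\<close>. Conversely, if \<open>\<nabla>\<omega> = 0\<close>, then
  \<open>T(ham x,ham y) z\<close> is antisymmetric in its first two arguments and symmetric in its last two; a
  trilinear expression with both symmetries vanishes.

  All objects are global, so local arguments need cutoff functions. These come from a smooth plateau
  function on the real line (\<open>exists_plateau\<close>, \<open>cutoff\<close>); multiplying by a cutoff turns expansions in
  a chart into identities between global forms or global vector fields
  (\<open>form1_decomposition\<close>, \<open>form2_decomposition\<close>, \<open>vfield_decomposition\<close>).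
\<close>

section \<open>Calculus of smooth functions\<close>

lemma Ck_on_subset: "Ck_on k S f \<Longrightarrow> T \<subseteq> S \<Longrightarrow> Ck_on k T f"
proof (induction k arbitrary: f)
  case 0
  then show ?case using continuous_on_subset by auto
next
  case (Suc k)
  then show ?case using differentiable_on_subset[of f S T] by simp
qed

lemma Ck_on_has_derivative:
  assumes "Ck_on (Suc k) S f" "open S" "x \<in> S"
  shows "(f has_derivative frechet_derivative f (at x)) (at x)"
proof -
  have "f differentiable at x"
    using assms at_within_open[OF assms(3,2)] by (simp add: differentiable_on_def) metis
  then show ?thesis by (simp add: frechet_derivative_works)
qed

lemma Ck_on_cong:
  assumes "open S" "\<And>x. x \<in> S \<Longrightarrow> f x = g x" "Ck_on k S f"
  shows "Ck_on k S g"
  using assms(2,3)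
proof (induction k arbitrary: f g)
  case 0
  then show ?case using continuous_on_cong[of S S f g] by auto
next
  case (Suc k)
  have d: "(f has_derivative frechet_derivative f (at x)) (at x)" if "x \<in> S" for x
    using Ck_on_has_derivative[OF Suc.prems(2) assms(1) that] .
  have g: "(g has_derivative frechet_derivative f (at x)) (at x)" if "x \<in> S" for x
    using has_derivative_transform_within_open[OF d[OF that] assms(1) that Suc.prems(1)] .
  have e: "frechet_derivative f (at x) = frechet_derivative g (at x)" if "x \<in> S" for x
    using frechet_derivative_at[OF g[OF that]] .
  have "g differentiable (at x within S)" if "x \<in> S" for x
    using g[OF that] differentiable_def has_derivative_at_withinI by blast
  then have "g differentiable_on S"
    by (simp add: differentiable_on_def)
  moreover have "Ck_on k S (\<lambda>x. frechet_derivative g (at x) v)" for v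
  proof (rule Suc.IH)
    show "frechet_derivative f (at x) v = frechet_derivative g (at x) v" if "x \<in> S" for x
      using e[OF that] by simp
    show "Ck_on k S (\<lambda>x. frechet_derivative f (at x) v)"
      using Suc.prems(2) by simp
  qed
  ultimately show ?case by simp
qed

lemma Ck_on_SucI:
  assumes "open S" "\<And>x. x \<in> S \<Longrightarrow> (f has_derivative f' x) (at x)"
    and "\<And>v. Ck_on k S (\<lambda>x. f' x v)"
  shows "Ck_on (Suc k) S f"
proof -
  have "f differentiable (at x within S)" if "x \<in> S" for x
    using assms(2)[OF that] differentiable_def has_derivative_at_withinI by blast
  then have "f differentiable_on S"
    by (simp add: differentiable_on_def)
  moreover have "Ck_on k S (\<lambda>x. frechet_derivative f (at x) v)" for v
    by (rule Ck_on_cong[OF assms(1) _ assms(3)[of v]])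
      (simp add: frechet_derivative_at[OF assms(2), symmetric])
  ultimately show ?thesis by simp
qed

lemma Ck_on_Suc_D: "Ck_on (Suc k) S f \<Longrightarrow> Ck_on k S f"
  by (induction k arbitrary: f) (simp_all add: differentiable_imp_continuous_on)

text \<open>
  Differentiability on an open set is a pointwise condition, so a function may be glued from pieces.
  Extensions by zero and coefficients that are known only near each point are handled in this way.
\<close>

lemma Ck_on_local:
  assumes "open S" "\<And>x. x \<in> S \<Longrightarrow> \<exists>T. open T \<and> x \<in> T \<and> Ck_on k T f"
  shows "Ck_on k S f"
  using assms(2)
proof (induction k arbitrary: f)
  case 0
  have "continuous (at x) f" if "x \<in> S" for x
    using 0[OF that] continuous_on_eq_continuous_at by auto
  then show ?case using assms(1) by (simp add: continuous_on_eq_continuous_at)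
next
  case (Suc k)
  have "f differentiable (at x within S)" if "x \<in> S" for x
    using Suc.prems[OF that] Ck_on_has_derivative differentiable_def has_derivative_at_withinI
    by blast
  then have "f differentiable_on S"
    by (simp add: differentiable_on_def)
  moreover have "Ck_on k S (\<lambda>x. frechet_derivative f (at x) v)" for v
    by (rule Suc.IH) (use Suc.prems in fastforce)
  ultimately show ?case by simp
qed

lemma Ck_on_const: "open S \<Longrightarrow> Ck_on k S (\<lambda>x. a)"
  by (induction k arbitrary: a) (auto simp: frechet_derivative_const)

lemma Ck_on_bounded_linear:
  assumes "bounded_linear L" "open S" "Ck_on k S f"
  shows "Ck_on k S (\<lambda>x. L (f x))"
  using assms(3)
proof (induction k arbitrary: f)
  case 0
  then show ?case using bounded_linear.continuous_on[OF assms(1)] by auto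
next
  case (Suc k)
  show ?case
    by (rule Ck_on_SucI[OF assms(2) bounded_linear.has_derivative[OF assms(1)
          Ck_on_has_derivative[OF Suc.prems assms(2)]]])
      (use Suc in auto)
qed

lemma Ck_on_add:
  assumes "open S" "Ck_on k S f" "Ck_on k S g"
  shows "Ck_on k S (\<lambda>x. f x + g x)"
  using assms(2,3)
proof (induction k arbitrary: f g)
  case 0
  then show ?case by (auto intro: continuous_on_add)
next
  case (Suc k)
  show ?case
    by (rule Ck_on_SucI[OF assms(1) has_derivative_add
          [OF Ck_on_has_derivative[OF Suc.prems(1) assms(1)]
              Ck_on_has_derivative[OF Suc.prems(2) assms(1)]]])
      (use Suc in auto)
qed

lemma Ck_on_bilinear:
  assumes "bounded_bilinear b" "open S" "Ck_on k S f" "Ck_on k S g"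
  shows "Ck_on k S (\<lambda>x. b (f x) (g x))"
  using assms(3,4)
proof (induction k arbitrary: f g)
  case 0
  then show ?case using bounded_bilinear.continuous_on[OF assms(1)] by auto
next
  case (Suc k)
  have "Ck_on k S f" "Ck_on k S g"
    using Suc.prems Ck_on_Suc_D by blast+
  then show ?case
    by (intro Ck_on_SucI[OF assms(2) bounded_bilinear.FDERIV[OF assms(1)
          Ck_on_has_derivative[OF Suc.prems(1) assms(2)]
          Ck_on_has_derivative[OF Suc.prems(2) assms(2)]]])
      (use Suc in \<open>auto intro!: Ck_on_add[OF assms(2)]\<close>)
qed

lemma Ck_on_sum:
  assumes "open S" "\<And>i. i \<in> I \<Longrightarrow> Ck_on k S (f i)"
  shows "Ck_on k S (\<lambda>x. \<Sum>i\<in>I. f i x)"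
  using assms(2)
  by (induction I rule: infinite_finite_induct)
    (auto intro: Ck_on_add[OF assms(1)] Ck_on_const[OF assms(1)])

text \<open>
  In the chain rule \<open>D(g \<circ> f)(x) v = Dg(f x)(Df(x) v)\<close> the point and the direction both depend on
  \<open>x\<close>. Expanding the direction in a finite basis leaves partial derivatives of \<open>g\<close> in fixed directions,
  composed with \<open>f\<close>, to which the induction hypothesis applies.
\<close>

lemma Ck_on_compose:
  fixes f :: "'a::real_normed_vector \<Rightarrow> 'b::euclidean_space"
  assumes "open S" "open T" "f ` S \<subseteq> T" "Ck_on k T g" "Ck_on k S f"
  shows "Ck_on k S (\<lambda>x. g (f x))"
  using assms(4,5)
proof (induction k arbitrary: g)
  case 0
  then show ?case using assms(3) by (auto intro: continuous_on_compose2)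
next
  case (Suc k)
  let ?g = "\<lambda>x. frechet_derivative g (at (f x))" and ?f = "\<lambda>x. frechet_derivative f (at x)"
  have g: "(g has_derivative ?g x) (at (f x))" if "x \<in> S" for x
    using Ck_on_has_derivative[OF Suc.prems(1) assms(2)] that assms(3) by auto
  have f: "(f has_derivative ?f x) (at x)" if "x \<in> S" for x
    using Ck_on_has_derivative[OF Suc.prems(2) assms(1) that] .
  have eq: "?g x (?f x v) = (\<Sum>i\<in>Basis. (?f x v \<bullet> i) *\<^sub>R ?g x i)" if "x \<in> S" for x v
  proof -
    have "linear (?g x)" using g[OF that] has_derivative_linear by blast
    then have "?g x (\<Sum>i\<in>Basis. (?f x v \<bullet> i) *\<^sub>R i) = (\<Sum>i\<in>Basis. (?f x v \<bullet> i) *\<^sub>R ?g x i)"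
      by (simp add: linear_sum linear_scale)
    then show ?thesis by (simp add: euclidean_representation)
  qed
  show ?case
  proof (rule Ck_on_SucI[OF assms(1)])
    show "((\<lambda>x. g (f x)) has_derivative (\<lambda>v. \<Sum>i\<in>Basis. (?f x v \<bullet> i) *\<^sub>R ?g x i)) (at x)"
      if "x \<in> S" for x
      using has_derivative_compose[OF f[OF that] g[OF that]] eq[OF that] by simp
    show "Ck_on k S (\<lambda>x. \<Sum>i\<in>Basis. (?f x v \<bullet> i) *\<^sub>R ?g x i)" for v
    proof (intro Ck_on_sum Ck_on_bilinear[OF bounded_bilinear_scaleR] assms(1))
      fix i :: 'b
      show "Ck_on k S (\<lambda>x. ?f x v \<bullet> i)"
        using Suc.prems(2) by (intro Ck_on_bounded_linear[OF bounded_linear_inner_left assms(1)]) auto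
      show "Ck_on k S (\<lambda>x. ?g x i)"
        by (rule Suc.IH) (use Suc.prems Ck_on_Suc_D in auto)
    qed
  qed
qed

lemma smooth_on_subset: "smooth_on S f \<Longrightarrow> T \<subseteq> S \<Longrightarrow> smooth_on T f"
  unfolding smooth_on_def using Ck_on_subset by blast

lemma smooth_on_cong:
  "open S \<Longrightarrow> smooth_on S f \<Longrightarrow> (\<And>x. x \<in> S \<Longrightarrow> f x = g x) \<Longrightarrow> smooth_on S g"
  unfolding smooth_on_def using Ck_on_cong by metis

lemma smooth_on_local:
  assumes "open S" "\<And>x. x \<in> S \<Longrightarrow> \<exists>T. open T \<and> x \<in> T \<and> smooth_on T f"
  shows "smooth_on S f"
  unfolding smooth_on_def using Ck_on_local[OF assms(1)] assms(2) unfolding smooth_on_def by meson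

lemma smooth_on_const: "open S \<Longrightarrow> smooth_on S (\<lambda>x. a)"
  by (simp add: smooth_on_def Ck_on_const)

lemma smooth_on_bounded_linear:
  "bounded_linear L \<Longrightarrow> open S \<Longrightarrow> smooth_on S f \<Longrightarrow> smooth_on S (\<lambda>x. L (f x))"
  by (simp add: smooth_on_def Ck_on_bounded_linear)

lemma smooth_on_add:
  "open S \<Longrightarrow> smooth_on S f \<Longrightarrow> smooth_on S g \<Longrightarrow> smooth_on S (\<lambda>x. f x + g x)"
  by (simp add: smooth_on_def Ck_on_add)

lemma smooth_on_scaleR:
  "open S \<Longrightarrow> smooth_on S f \<Longrightarrow> smooth_on S g \<Longrightarrow> smooth_on S (\<lambda>x. f x *\<^sub>R g x)"
  by (simp add: smooth_on_def Ck_on_bilinear[OF bounded_bilinear_scaleR])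

lemma smooth_on_mult:
  fixes f g :: "_ \<Rightarrow> real"
  shows "open S \<Longrightarrow> smooth_on S f \<Longrightarrow> smooth_on S g \<Longrightarrow> smooth_on S (\<lambda>x. f x * g x)"
  using smooth_on_scaleR[of S f g] by simp

lemma smooth_on_sum:
  "open S \<Longrightarrow> (\<And>i. i \<in> I \<Longrightarrow> smooth_on S (f i)) \<Longrightarrow> smooth_on S (\<lambda>x. \<Sum>i\<in>I. f i x)"
  by (simp add: smooth_on_def Ck_on_sum)

lemma smooth_on_compose:
  fixes f :: "'a::real_normed_vector \<Rightarrow> 'b::euclidean_space"
  shows "open S \<Longrightarrow> open T \<Longrightarrow> f ` S \<subseteq> T \<Longrightarrow> smooth_on T g \<Longrightarrow> smooth_on S f \<Longrightarrow>
    smooth_on S (\<lambda>x. g (f x))"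
  unfolding smooth_on_def using Ck_on_compose by blast

lemma smooth_on_ident: "open S \<Longrightarrow> smooth_on S (\<lambda>x. x)"
  unfolding smooth_on_def
proof
  fix k assume "open S"
  then show "Ck_on k S (\<lambda>x. x)"
    by (cases k) (auto simp: frechet_derivative_ident Ck_on_const)
qed

lemma smooth_on_diff:
  fixes f g :: "_ \<Rightarrow> 'b::real_normed_vector"
  assumes "open S" "smooth_on S f" "smooth_on S g"
  shows "smooth_on S (\<lambda>x. f x - g x)"
  using smooth_on_add[OF assms(1,2) smooth_on_bounded_linear
      [OF bounded_linear_scaleR_right[of "-1"] assms(1,3)]] by simp

lemma smooth_on_has_derivative:
  assumes "smooth_on S f" "open S" "x \<in> S"
  shows "(f has_derivative frechet_derivative f (at x)) (at x)"
  using Ck_on_has_derivative[of 0, OF _ assms(2,3)] assms(1) unfolding smooth_on_def by blast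

section \<open>A plateau function\<close>

text \<open>
  The case \<open>m = 0\<close> is the standard function with all derivatives zero at the origin. Its derivatives
  are combinations of members with larger \<open>m\<close>, so that one induction over the whole family covers
  all orders.
\<close>

definition flat :: "nat \<Rightarrow> real \<Rightarrow> real"
  where "flat m t = (if t \<le> 0 then 0 else (1 / t) ^ m * exp (- 1 / t))"

text \<open>
  With \<open>s = 1/t\<close> this is the decay of \<open>s\<^sup>m / exp s\<close> at infinity.
\<close>

lemma flat_tendsto_0: "(flat m \<longlongrightarrow> 0) (at 0)"
proof -
  have "((\<lambda>t. (inverse t) ^ m / exp (inverse t)) \<longlongrightarrow> (0::real)) (at_right 0)"
    using filterlim_compose[OF tendsto_power_div_exp_0 filterlim_inverse_at_top_right] .
  then have "(flat m \<longlongrightarrow> 0) (at_right 0)"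
    by (rule Lim_transform_eventually)
      (auto simp: eventually_at_filter flat_def exp_minus divide_simps)
  moreover have "(flat m \<longlongrightarrow> 0) (at_left 0)"
    by (rule Lim_transform_eventually[OF tendsto_const])
      (auto simp: eventually_at_filter flat_def)
  ultimately show ?thesis by (simp add: filterlim_at_split)
qed

lemma flat_has_derivative:
  "(flat m has_real_derivative flat (m + 2) t - m * flat (m + 1) t) (at t)"
proof -
  consider "t < 0" | "t = 0" | "t > 0" by linarith
  then show ?thesis
  proof cases
    case 1
    have "(flat m has_real_derivative 0) (at t)"
      by (rule has_field_derivative_transform_within_open[of "\<lambda>_. 0" _ _ "{..<0}"])
        (use 1 in \<open>auto simp: flat_def\<close>)
    then show ?thesis using 1 by (simp add: flat_def)
  next
    case 2
    have "((\<lambda>h. (flat m (0 + h) - flat m 0) / h) \<longlongrightarrow> 0) (at 0)"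
      by (rule Lim_transform_eventually[OF flat_tendsto_0[of "Suc m"]])
        (auto simp: flat_def eventually_at_filter)
    then show ?thesis using 2 by (simp add: DERIV_def flat_def)
  next
    case 3
    have "((\<lambda>s. (1 / s) ^ m * exp (- 1 / s)) has_real_derivative
        flat (m + 2) t - m * flat (m + 1) t) (at t)"
    proof -
      have "((\<lambda>s. inverse s ^ m * exp (- inverse s)) has_real_derivative
          m * (- (inverse t ^ 2) * inverse t ^ (m - 1)) * exp (- inverse t)
            + exp (- inverse t) * inverse t ^ 2 * inverse t ^ m) (at t)"
        using 3 by (auto intro!: derivative_eq_intros simp: power2_eq_square)
      moreover have "flat k t = inverse t ^ k * exp (- inverse t)" for k
        using 3 by (simp add: flat_def inverse_eq_divide)
      then have "m * (- (inverse t ^ 2) * inverse t ^ (m - 1)) * exp (- inverse t)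
            + exp (- inverse t) * inverse t ^ 2 * inverse t ^ m = flat (m + 2) t - m * flat (m + 1) t"
        by (cases m) (simp_all add: power2_eq_square algebra_simps)
      ultimately have "((\<lambda>s. inverse s ^ m * exp (- inverse s)) has_real_derivative
          flat (m + 2) t - m * flat (m + 1) t) (at t)"
        by metis
      then show ?thesis by (simp add: inverse_eq_divide)
    qed
    then show ?thesis
      by (rule has_field_derivative_transform_within_open[of _ _ _ "{0<..}"])
        (use 3 in \<open>auto simp: flat_def\<close>)
  qed
qed

lemma smooth_on_flat: "smooth_on UNIV (flat m)"
  unfolding smooth_on_def
proof
  show "Ck_on k UNIV (flat m)" for k
  proof (induction k arbitrary: m)
    case 0
    have "continuous_on UNIV (flat m)"
      using DERIV_isCont[OF flat_has_derivative[of m]] by (simp add: continuous_on_eq_continuous_at)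
    then show ?case by simp
  next
    case (Suc k)
    show ?case
    proof (rule Ck_on_SucI)
      have "(*) (flat (m + 2) t - m * flat (m + 1) t) =
          (\<lambda>v. flat (m + 2) t * v + (- m * flat (m + 1) t) * v)" for t
        by (simp add: fun_eq_iff algebra_simps)
      then show "(flat m has_derivative
          (\<lambda>v. flat (m + 2) t * v + (- m * flat (m + 1) t) * v)) (at t)" for t
        using flat_has_derivative[of m t] by (metis has_field_derivative_def)
      show "Ck_on k UNIV (\<lambda>t. flat (m + 2) t * v + (- m * flat (m + 1) t) * v)" for v
        using Suc.IH
        by (intro Ck_on_add Ck_on_bounded_linear[OF bounded_linear_mult_left]
            Ck_on_bounded_linear[OF bounded_linear_mult_right]) auto
    qed auto
  qed
qed

text \<open>
  For \<open>h = flat 0\<close> the function \<open>h (1 - K h(s - a))\<close> is constant where \<open>h (s - a) = 0\<close>, that is for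
  \<open>s \<le> a\<close>, and vanishes as soon as \<open>K h(s - a) \<ge> 1\<close>; the constant \<open>K\<close> places that point at \<open>b\<close>.
\<close>

lemma exists_plateau:
  fixes a b :: real
  assumes "a < b"
  obtains g :: "real \<Rightarrow> real" where "smooth_on UNIV g" "\<And>s. s \<le> a \<Longrightarrow> g s = 1" "\<And>s. s \<ge> b \<Longrightarrow> g s = 0"
proof -
  define K where "K = 1 / flat 0 (b - a)"
  define g where "g s = flat 0 (1 - K * flat 0 (s - a)) * exp 1" for s
  have inner: "smooth_on UNIV (\<lambda>s. flat 0 (s - a))"
    using smooth_on_compose[OF open_UNIV open_UNIV _ smooth_on_flat smooth_on_diff
        [OF open_UNIV smooth_on_ident smooth_on_const]] by auto
  have "smooth_on UNIV (\<lambda>s. flat 0 (1 - K * flat 0 (s - a)))"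
    using smooth_on_compose[OF open_UNIV open_UNIV _ smooth_on_flat smooth_on_diff
        [OF open_UNIV smooth_on_const smooth_on_mult[OF open_UNIV smooth_on_const inner]]] by auto
  then have "smooth_on UNIV g"
    unfolding g_def by (intro smooth_on_mult smooth_on_const) auto
  moreover have "g s = 1" if "s \<le> a" for s
    using that by (simp add: g_def flat_def flip: exp_add)
  moreover have "g s = 0" if "s \<ge> b" for s
  proof -
    have "flat 0 (b - a) > 0" using assms by (simp add: flat_def)
    moreover have "flat 0 (b - a) \<le> flat 0 (s - a)"
      using assms that by (simp add: flat_def frac_le)
    ultimately have "K * flat 0 (s - a) \<ge> 1" by (simp add: K_def)
    then show ?thesis by (simp add: g_def flat_def)
  qed
  ultimately show ?thesis using that by blast
qed

section \<open>Smooth functions on a manifold\<close>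

lemma sum_fun_apply: "(\<Sum>i\<in>I. F i) x = (\<Sum>i\<in>I. F i x)"
  by (induction I rule: infinite_finite_induct) auto

lemma linear_axis_expansion:
  fixes f :: "real ^ 'n::finite \<Rightarrow> real"
  assumes "linear f" shows "f a = (\<Sum>i\<in>UNIV. a $ i * f (axis i 1))"
proof -
  have "a = (\<Sum>i\<in>UNIV. a $ i *\<^sub>R axis i 1)"
    using basis_expansion[of a] by (simp add: scalar_mult_eq_scaleR)
  then have "f a = f (\<Sum>i\<in>UNIV. a $ i *\<^sub>R axis i 1)" by simp
  then show ?thesis
    by (simp add: linear_sum[OF assms] linear_scale[OF assms])
qed

locale smooth_manifold =
  fixes A :: "('a::{t2_space, second_countable_topology}, 'n::finite) chart set"
  assumes atlas: "smooth_atlas A"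
begin

lemma chart_at: obtains c where "c \<in> A" "p \<in> fst c"
proof -
  have "p \<in> (\<Union>c\<in>A. fst c)" using atlas by (simp add: smooth_atlas_def)
  then show ?thesis using that by blast
qed

lemma open_chart_domain: "c \<in> A \<Longrightarrow> open (fst c)"
  using atlas by (simp add: smooth_atlas_def)

lemma open_chart_range: "c \<in> A \<Longrightarrow> open (snd c ` fst c)"
  using atlas by (simp add: smooth_atlas_def)

lemma chart_homeomorphism:
  "c \<in> A \<Longrightarrow> homeomorphism (fst c) (snd c ` fst c) (snd c) (chart_inv c)"
  using atlas by (simp add: smooth_atlas_def)

lemma smooth_transition:
  "\<lbrakk>c \<in> A; c' \<in> A\<rbrakk> \<Longrightarrow> smooth_on (snd c ` (fst c \<inter> fst c')) (\<lambda>z. snd c' (chart_inv c z))"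
  using atlas by (simp add: smooth_atlas_def comp_def)

lemma chart_inv_chart [simp]: "c \<in> A \<Longrightarrow> p \<in> fst c \<Longrightarrow> chart_inv c (snd c p) = p"
  using homeomorphism_apply1[OF chart_homeomorphism] .

lemma open_chart_image:
  assumes "c \<in> A" "open W" "W \<subseteq> fst c"
  shows "open (snd c ` W)"
proof -
  have "openin (top_of_set (fst c)) W"
    using assms open_chart_domain by (simp add: openin_open_eq)
  then have "openin (top_of_set (snd c ` fst c)) (snd c ` W)"
    using homeomorphism_imp_open_map[OF chart_homeomorphism] assms(1) by blast
  then show ?thesis
    using open_chart_range assms(1) openin_open_eq by blast
qed

lemma Cinf_smooth: "f \<in> Cinf A \<Longrightarrow> c \<in> A \<Longrightarrow> smooth_on (snd c ` fst c) (\<lambda>z. f (chart_inv c z))"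
  by (simp add: Cinf_def comp_def)

lemma CinfI:
  "(\<And>c. c \<in> A \<Longrightarrow> smooth_on (snd c ` fst c) (\<lambda>z. f (chart_inv c z))) \<Longrightarrow> f \<in> Cinf A"
  by (simp add: Cinf_def comp_def)

lemma Cinf_const: "(\<lambda>_. r) \<in> Cinf A"
  by (intro CinfI smooth_on_const open_chart_range)

lemma Cinf_add: "f \<in> Cinf A \<Longrightarrow> g \<in> Cinf A \<Longrightarrow> (\<lambda>q. f q + g q) \<in> Cinf A"
  by (rule CinfI, rule smooth_on_add) (simp_all add: open_chart_range Cinf_smooth)

lemma Cinf_diff: "f \<in> Cinf A \<Longrightarrow> g \<in> Cinf A \<Longrightarrow> (\<lambda>q. f q - g q) \<in> Cinf A"
  by (rule CinfI, rule smooth_on_diff) (simp_all add: open_chart_range Cinf_smooth)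

lemma Cinf_mult: "f \<in> Cinf A \<Longrightarrow> g \<in> Cinf A \<Longrightarrow> (\<lambda>q. f q * g q) \<in> Cinf A"
  by (rule CinfI, rule smooth_on_mult) (simp_all add: open_chart_range Cinf_smooth)

lemma Cinf_sum: "(\<And>i. i \<in> I \<Longrightarrow> f i \<in> Cinf A) \<Longrightarrow> (\<lambda>q. \<Sum>i\<in>I. f i q) \<in> Cinf A"
  by (induction I rule: infinite_finite_induct) (auto intro: Cinf_add Cinf_const)

text \<open>
  Transport a plateau function of the squared distance to \<open>p\<close> through the chart. Its support in the
  chart is compact, hence closed in the Hausdorff space \<open>'a\<close>, and this is why a product with it can be
  extended by zero to a smooth function on the whole manifold.
\<close>

lemma cutoff:
  assumes c: "c \<in> A" and W: "open W" "p \<in> W" "W \<subseteq> fst c"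
  obtains \<psi> N where "open N" "p \<in> N" "N \<subseteq> W"
    "\<forall>q\<in>N. \<psi> q = 1" "\<forall>q. q \<notin> W \<longrightarrow> \<psi> q = (0::real)"
    "\<forall>g. smooth_on (snd c ` fst c) g \<longrightarrow> (\<lambda>q. \<psi> q * g (snd c q)) \<in> Cinf A"
proof -
  let ?x = "snd c p"
  have "open (snd c ` W)" "?x \<in> snd c ` W" using open_chart_image[OF c W(1,3)] W(2) by auto
  then obtain e where e: "e > 0" "cball ?x e \<subseteq> snd c ` W"
    using open_contains_cball by metis
  have "(e / 2)\<^sup>2 < e\<^sup>2" using e(1) by (intro power_strict_mono) auto
  from exists_plateau[OF this] obtain h :: "real \<Rightarrow> real" where h: "smooth_on UNIV h"
    "\<And>s. s \<le> (e / 2)\<^sup>2 \<Longrightarrow> h s = 1" "\<And>s. s \<ge> e\<^sup>2 \<Longrightarrow> h s = 0"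
    by blast
  define \<rho> where "\<rho> z = h (inner (z - ?x) (z - ?x))" for z
  have "smooth_on UNIV (\<lambda>z. z - ?x)"
    by (intro smooth_on_diff smooth_on_ident smooth_on_const) auto
  then have "smooth_on UNIV (\<lambda>z. inner (z - ?x) (z - ?x))"
    unfolding smooth_on_def by (auto intro: Ck_on_bilinear[OF bounded_bilinear_inner])
  then have \<rho>: "smooth_on UNIV \<rho>"
    unfolding \<rho>_def using smooth_on_compose[OF open_UNIV open_UNIV _ h(1)] by auto
  have \<rho>1: "\<rho> z = 1" if "dist ?x z \<le> e / 2" for z
    using that power_mono[of "dist ?x z" "e / 2" 2]
    by (simp add: \<rho>_def h(2) dist_norm norm_minus_commute flip: power2_norm_eq_inner)
  have \<rho>0: "\<rho> z = 0" if "z \<notin> cball ?x e" for z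
    using that power_mono[of e "dist ?x z" 2] e(1)
    by (simp add: \<rho>_def h(3) dist_norm norm_minus_commute flip: power2_norm_eq_inner)
  define \<psi> where "\<psi> q = (if q \<in> fst c then \<rho> (snd c q) else 0)" for q
  define K where "K = chart_inv c ` cball ?x e"
  have sub: "cball ?x e \<subseteq> snd c ` fst c" using e(2) W(3) by blast
  have "continuous_on (cball ?x e) (chart_inv c)"
    using chart_homeomorphism[OF c] sub by (meson continuous_on_subset homeomorphism_cont2)
  then have K: "closed K"
    unfolding K_def by (intro compact_imp_closed compact_continuous_image compact_cball)
  have KW: "K \<subseteq> W"
  proof
    fix q assume "q \<in> K"
    then obtain z where "z \<in> cball ?x e" "q = chart_inv c z" unfolding K_def by blast
    then obtain q' where "q' \<in> W" "q = chart_inv c (snd c q')" using e(2) by blast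
    then show "q \<in> W" using chart_inv_chart[OF c] W(3) by auto
  qed
  have \<psi>K: "\<psi> q = 0" if "q \<notin> K" for q
  proof (cases "q \<in> fst c")
    case True
    then have "snd c q \<notin> cball ?x e" using that c K_def by (metis chart_inv_chart imageI)
    then show ?thesis using \<rho>0 by (simp add: \<psi>_def)
  qed (simp add: \<psi>_def)
  define N where "N = W \<inter> (snd c -` ball ?x (e / 2) \<inter> fst c)"
  have "continuous_on (fst c) (snd c)"
    using chart_homeomorphism[OF c] homeomorphism_cont1 by blast
  then have "open N"
    unfolding N_def using W(1) continuous_on_open_vimage[OF open_chart_domain[OF c]]
    by (blast intro: open_Int open_ball)
  moreover have "p \<in> N" using W e(1) by (auto simp: N_def)
  moreover have "\<psi> q = 1" if "q \<in> N" for q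
    using that \<rho>1 by (auto simp: N_def \<psi>_def)
  moreover have "(\<lambda>q. \<psi> q * g (snd c q)) \<in> Cinf A" if g: "smooth_on (snd c ` fst c) g" for g
  proof (rule CinfI)
    fix c' assume c': "c' \<in> A"
    show "smooth_on (snd c' ` fst c') (\<lambda>z. \<psi> (chart_inv c' z) * g (snd c (chart_inv c' z)))"
      (is "smooth_on _ ?f")
    proof (rule smooth_on_local[OF open_chart_range[OF c']])
      fix z assume "z \<in> snd c' ` fst c'"
      then obtain q where q: "q \<in> fst c'" "z = snd c' q" by blast
      \<comment> \<open>Either the point lies in the chart \<open>c\<close>, or it has a neighbourhood on which the cutoff vanishes.\<close>
      show "\<exists>T. open T \<and> z \<in> T \<and> smooth_on T ?f"
      proof (cases "q \<in> fst c")
        case True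
        let ?T = "snd c' ` (fst c' \<inter> fst c)"
        have T: "open ?T"
          using open_chart_image[OF c'(1) open_Int[OF open_chart_domain[OF c'(1)] open_chart_domain[OF c(1)]]]
    by simp
        have "smooth_on (snd c ` fst c) (\<lambda>y. \<rho> y * g y)"
          by (intro smooth_on_mult smooth_on_subset[OF \<rho>] g open_chart_range c) auto
        moreover have "(\<lambda>z. snd c (chart_inv c' z)) ` ?T \<subseteq> snd c ` fst c"
          using c' by auto
        ultimately have "smooth_on ?T (\<lambda>z. \<rho> (snd c (chart_inv c' z)) * g (snd c (chart_inv c' z)))"
          using smooth_on_compose[OF T open_chart_range[OF c] _ _ smooth_transition[OF c' c]] by blast
        then have "smooth_on ?T ?f"
          by (rule smooth_on_cong[OF T]) (use c' in \<open>auto simp: \<psi>_def\<close>)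
        then show ?thesis using T q True by blast
      next
        case False
        let ?T = "snd c' ` (fst c' - K)"
        have T: "open ?T"
          using open_chart_image[OF c' open_Diff[OF open_chart_domain[OF c'] K]] by simp
        have "smooth_on ?T ?f"
          by (rule smooth_on_cong[OF T smooth_on_const[OF T, of 0]]) (use c' \<psi>K in auto)
        moreover have "z \<in> ?T" using q False KW W(3) by blast
        ultimately show ?thesis using T by blast
      qed
    qed
  qed
  ultimately show ?thesis
    using that[of N \<psi>] \<psi>K KW unfolding N_def by blast
qed

section \<open>Tangent vectors\<close>

lemma tvec_apply:
  "f \<in> Cinf A \<Longrightarrow> tvec A c p a f = frechet_derivative (\<lambda>z. f (chart_inv c z)) (at (snd c p)) a"
  by (simp add: tvec_def comp_def)

lemma tvec_outside: "f \<notin> Cinf A \<Longrightarrow> tvec A c p a f = 0"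
  by (simp add: tvec_def)

lemma chart_has_derivative:
  assumes "f \<in> Cinf A" "c \<in> A" "p \<in> fst c"
  shows "((\<lambda>z. f (chart_inv c z)) has_derivative (\<lambda>a. tvec A c p a f)) (at (snd c p))"
proof -
  have "(\<lambda>a. tvec A c p a f) = frechet_derivative (\<lambda>z. f (chart_inv c z)) (at (snd c p))"
    using tvec_apply[OF assms(1)] by (simp add: fun_eq_iff)
  then show ?thesis
    using smooth_on_has_derivative[OF Cinf_smooth[OF assms(1,2)] open_chart_range[OF assms(2)]]
      assms(3) by simp
qed

lemma tvec_eqI:
  assumes "f \<in> Cinf A" "((\<lambda>z. f (chart_inv c z)) has_derivative F) (at (snd c p))"
  shows "tvec A c p a f = F a"
  using frechet_derivative_at[OF assms(2)] assms(1) by (simp add: tvec_apply)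

lemma tvec_linear: "c \<in> A \<Longrightarrow> p \<in> fst c \<Longrightarrow> linear (\<lambda>a. tvec A c p a f)"
  using has_derivative_linear[OF chart_has_derivative]
  by (cases "f \<in> Cinf A") (auto simp: tvec_outside module_hom_zero)

lemma tvec_add: "c \<in> A \<Longrightarrow> p \<in> fst c \<Longrightarrow> tvec A c p (a + b) = tvec A c p a + tvec A c p b"
  using linear_add[OF tvec_linear] by (simp add: fun_eq_iff)

lemma tvec_scale: "c \<in> A \<Longrightarrow> p \<in> fst c \<Longrightarrow> tvec A c p (r *\<^sub>R a) = (\<lambda>f. r * tvec A c p a f)"
  using linear_scale[OF tvec_linear] by (simp add: fun_eq_iff)

lemma tvec_partial:
  assumes "c \<in> A" "p \<in> fst c"
  shows "tvec A c p a f = (\<Sum>i\<in>UNIV. a $ i * partial A c i p f)"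
  unfolding partial_def by (rule linear_axis_expansion[OF tvec_linear[OF assms]])

lemma tangentE:
  assumes "v \<in> tangent A p" obtains c a where "c \<in> A" "p \<in> fst c" "v = tvec A c p a"
  using assms unfolding tangent_def by blast

lemma tvec_tangent: "c \<in> A \<Longrightarrow> p \<in> fst c \<Longrightarrow> tvec A c p a \<in> tangent A p"
  unfolding tangent_def by blast

lemma partial_tangent: "c \<in> A \<Longrightarrow> p \<in> fst c \<Longrightarrow> partial A c i p \<in> tangent A p"
  unfolding partial_def by (rule tvec_tangent)

lemma tangent_outside: "v \<in> tangent A p \<Longrightarrow> f \<notin> Cinf A \<Longrightarrow> v f = 0"
  using tvec_outside by (auto elim!: tangentE)

lemma tangent_ext:
  assumes "v \<in> tangent A p" "w \<in> tangent A p" "\<And>f. f \<in> Cinf A \<Longrightarrow> v f = w f"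
  shows "v = w"
  using assms tangent_outside by (metis ext)

lemma tangent_fun_add:
  assumes "v \<in> tangent A p" "f \<in> Cinf A" "g \<in> Cinf A"
  shows "v (\<lambda>q. f q + g q) = v f + v g"
  using assms by (auto elim!: tangentE
      intro!: tvec_eqI has_derivative_add chart_has_derivative Cinf_add)

lemma tangent_fun_diff:
  assumes "v \<in> tangent A p" "f \<in> Cinf A" "g \<in> Cinf A"
  shows "v (\<lambda>q. f q - g q) = v f - v g"
  using assms by (auto elim!: tangentE
      intro!: tvec_eqI has_derivative_diff chart_has_derivative Cinf_diff)

lemma tangent_fun_mult:
  assumes "v \<in> tangent A p" "f \<in> Cinf A" "g \<in> Cinf A"
  shows "v (\<lambda>q. f q * g q) = f p * v g + v f * g p"
proof -
  obtain c a where c: "c \<in> A" "p \<in> fst c" "v = tvec A c p a" using tangentE[OF assms(1)] .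
  show ?thesis
    unfolding c(3) using has_derivative_mult[OF chart_has_derivative[OF assms(2) c(1,2)]
        chart_has_derivative[OF assms(3) c(1,2)]] c(1,2)
    by (intro tvec_eqI Cinf_mult assms(2,3)) simp
qed

lemma tangent_fun_const: "v \<in> tangent A p \<Longrightarrow> v (\<lambda>_. r) = 0"
  using tvec_eqI[OF Cinf_const has_derivative_const] by (auto elim!: tangentE)

lemma tangent_fun_sum:
  assumes "v \<in> tangent A p" "\<And>i. i \<in> I \<Longrightarrow> f i \<in> Cinf A"
  shows "v (\<lambda>q. \<Sum>i\<in>I. f i q) = (\<Sum>i\<in>I. v (f i))"
  using assms(2)
proof (induction I rule: infinite_finite_induct)
  case (insert i I)
  then show ?case using tangent_fun_add[OF assms(1)] Cinf_sum[of I f] by simp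
qed (simp_all add: tangent_fun_const[OF assms(1)])

text \<open>
  A tangent vector only sees the germ of a function: if \<open>f\<close> is given near \<open>p\<close> by an expression \<open>g\<close> in
  the coordinates, its derivatives at \<open>p\<close> are those of \<open>g\<close>.
\<close>

lemma tvec_local:
  assumes "c \<in> A" "p \<in> fst c" "f \<in> Cinf A" "open N" "p \<in> N"
    and "\<And>q. q \<in> N \<Longrightarrow> q \<in> fst c \<Longrightarrow> f q = g (snd c q)"
    and "(g has_derivative G) (at (snd c p))"
  shows "tvec A c p a f = G a"
proof (rule tvec_eqI[OF assms(3)])
  have "open (snd c ` (N \<inter> fst c))"
    using open_chart_image[OF assms(1) open_Int[OF assms(4) open_chart_domain[OF assms(1)]]] by simp
  then show "((\<lambda>z. f (chart_inv c z)) has_derivative G) (at (snd c p))"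
    by (rule has_derivative_transform_within_open[OF assms(7)]) (use assms in auto)
qed

lemma tangent_locally_const:
  assumes "v \<in> tangent A p" "f \<in> Cinf A" "open N" "p \<in> N" "\<And>q. q \<in> N \<Longrightarrow> f q = r"
  shows "v f = 0"
  using assms(1) by (rule tangentE) (use tvec_local[OF _ _ assms(2,3,4) _ has_derivative_const] assms(5) in auto)

text \<open>
  Global functions which are the coordinates of \<open>c\<close> near \<open>p\<close>. Testing against them recovers the
  components of a tangent vector, although tangent vectors act on global functions only.
\<close>

lemma local_coordinates:
  assumes c: "c \<in> A" and p: "p \<in> fst c"
  obtains W and y :: "'n \<Rightarrow> 'a \<Rightarrow> real" where "open W" "p \<in> W" "W \<subseteq> fst c" "\<And>j. y j \<in> Cinf A"
    "\<And>q a j. q \<in> W \<Longrightarrow> tvec A c q a (y j) = a $ j"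
proof -
  obtain \<psi> W where W: "open W" "p \<in> W" "W \<subseteq> fst c" "\<And>q. q \<in> W \<Longrightarrow> \<psi> q = (1::real)"
    and \<psi>: "\<forall>g. smooth_on (snd c ` fst c) g \<longrightarrow> (\<lambda>q. \<psi> q * g (snd c q)) \<in> Cinf A"
    using cutoff[OF c open_chart_domain[OF c] p subset_refl] by metis
  define y where "y j q = \<psi> q * (snd c q $ j)" for j :: 'n and q
  have y: "y j \<in> Cinf A" for j
    unfolding y_def using smooth_on_bounded_linear[OF bounded_linear_vec_nth open_chart_range[OF c]
        smooth_on_ident[OF open_chart_range[OF c]]]
    by (intro \<psi>[rule_format]) simp
  have "tvec A c q a (y j) = a $ j" if "q \<in> W" for q a j
    using that W(3)
    by (intro tvec_local[OF c _ y W(1) that, where g = "\<lambda>z. z $ j"])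
      (auto simp: y_def W(4) intro: bounded_linear_imp_has_derivative bounded_linear_vec_nth)
  then show ?thesis using that W y by blast
qed

lemma tvec_inj: "c \<in> A \<Longrightarrow> p \<in> fst c \<Longrightarrow> tvec A c p a = tvec A c p b \<longleftrightarrow> a = b"
  by (metis local_coordinates vec_eq_iff)

lemma coords_tvec: "c \<in> A \<Longrightarrow> p \<in> fst c \<Longrightarrow> coords A c p (tvec A c p a) = a"
  unfolding coords_def by (simp add: tvec_inj)

text \<open>
  The new components are the old ones under the derivative of the transition map.
\<close>

lemma tvec_change_chart:
  assumes c: "c \<in> A" "p \<in> fst c" and c': "c' \<in> A" "p \<in> fst c'"
  shows "\<exists>b. tvec A c' p a = tvec A c p b"
proof -
  let ?t = "\<lambda>z. snd c (chart_inv c' z)" and ?T = "snd c' ` (fst c' \<inter> fst c)"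
  let ?b = "frechet_derivative ?t (at (snd c' p)) a"
  have T: "open ?T"
    using open_chart_image[OF c'(1) open_Int[OF open_chart_domain[OF c'(1)] open_chart_domain[OF c(1)]]]
    by simp
  have t: "(?t has_derivative frechet_derivative ?t (at (snd c' p))) (at (snd c' p))"
    using smooth_on_has_derivative[OF smooth_transition[OF c'(1) c(1)] T] c c' by blast
  have "tvec A c' p a f = tvec A c p ?b f" if f: "f \<in> Cinf A" for f
  proof (rule tvec_eqI[OF f])
    have "((\<lambda>z. f (chart_inv c z)) has_derivative (\<lambda>a. tvec A c p a f)) (at (?t (snd c' p)))"
      using chart_has_derivative[OF f c] c' by simp
    from has_derivative_compose[OF t this]
    show "((\<lambda>z. f (chart_inv c' z)) has_derivative
        (\<lambda>a. tvec A c p (frechet_derivative ?t (at (snd c' p)) a) f)) (at (snd c' p))"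
      by (rule has_derivative_transform_within_open[OF _ T]) (use c c' in auto)
  qed
  then have "tvec A c' p a = tvec A c p ?b"
    using tvec_tangent c c' by (intro tangent_ext[of _ p])
  then show ?thesis by blast
qed

lemma tangent_eq:
  assumes "c \<in> A" "p \<in> fst c" shows "tangent A p = range (tvec A c p)"
proof
  show "tangent A p \<subseteq> range (tvec A c p)"
  proof
    fix v assume "v \<in> tangent A p"
    then obtain c' a where "c' \<in> A" "p \<in> fst c'" "v = tvec A c' p a" by (rule tangentE)
    then show "v \<in> range (tvec A c p)" using tvec_change_chart[OF assms] by blast
  qed
  show "range (tvec A c p) \<subseteq> tangent A p" using tvec_tangent[OF assms] by blast
qed

lemma tvec_coords:
  assumes "c \<in> A" "p \<in> fst c" "v \<in> tangent A p" shows "tvec A c p (coords A c p v) = v"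
proof -
  obtain a where "v = tvec A c p a" using assms tangent_eq[OF assms(1,2)] by blast
  then show ?thesis by (simp add: coords_tvec assms)
qed

lemma tangent_add:
  assumes "v \<in> tangent A p" "w \<in> tangent A p" shows "v + w \<in> tangent A p"
proof -
  obtain c where c: "c \<in> A" "p \<in> fst c" by (rule chart_at)
  have "v + w = tvec A c p (coords A c p v + coords A c p w)"
    by (simp only: tvec_add[OF c] tvec_coords[OF c] assms)
  then show ?thesis by (simp only: tvec_tangent[OF c])
qed

lemma tangent_scale:
  assumes "v \<in> tangent A p" shows "(\<lambda>f. r * v f) \<in> tangent A p"
proof -
  obtain c where c: "c \<in> A" "p \<in> fst c" by (rule chart_at)
  have "(\<lambda>f. r * v f) = tvec A c p (r *\<^sub>R coords A c p v)"
    by (simp only: tvec_scale[OF c] tvec_coords[OF c] assms)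
  then show ?thesis by (simp only: tvec_tangent[OF c])
qed

text \<open>
  The working tool for all local expansions: coordinates \<open>y\<close> on a neighbourhood \<open>W\<close> of \<open>p\<close> and a
  cutoff \<open>\<psi>\<close> supported in \<open>W\<close>. The condition \<open>v \<psi> = 0\<close>, which holds since \<open>\<psi>\<close> is constant near \<open>p\<close>,
  lets derivations at \<open>p\<close> ignore the factor \<open>\<psi>\<close>.
\<close>

lemma cutoff_coordinates:
  assumes c: "c \<in> A" and p: "p \<in> fst c"
  obtains W and y :: "'n \<Rightarrow> 'a \<Rightarrow> real" and \<psi> where "p \<in> W" "W \<subseteq> fst c"
    "\<forall>j. y j \<in> Cinf A" "\<forall>q\<in>W. \<forall>a j. tvec A c q a (y j) = a $ j"
    "\<psi> \<in> Cinf A" "\<psi> p = 1" "\<forall>v\<in>tangent A p. v \<psi> = 0" "\<forall>q. q \<notin> W \<longrightarrow> \<psi> q = 0"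
    "\<forall>g. smooth_on (snd c ` fst c) g \<longrightarrow> (\<lambda>q. \<psi> q * g (snd c q)) \<in> Cinf A"
proof -
  obtain W and y :: "'n \<Rightarrow> 'a \<Rightarrow> real" where W: "open W" "p \<in> W" "W \<subseteq> fst c"
    and y: "\<And>j. y j \<in> Cinf A" "\<And>q a j. q \<in> W \<Longrightarrow> tvec A c q a (y j) = a $ j"
    by (rule local_coordinates[OF c p], rule that) (assumption | blast)+
  obtain \<psi> N where N: "open N" "p \<in> N" "N \<subseteq> W" "\<forall>q\<in>N. \<psi> q = 1" "\<forall>q. q \<notin> W \<longrightarrow> \<psi> q = (0::real)"
    and \<psi>: "\<forall>g. smooth_on (snd c ` fst c) g \<longrightarrow> (\<lambda>q. \<psi> q * g (snd c q)) \<in> Cinf A"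
    by (rule cutoff[OF c W])
  have "\<psi> \<in> Cinf A"
    using \<psi>[rule_format, OF smooth_on_const[OF open_chart_range[OF c], of 1]] by simp
  moreover from this have "v \<psi> = 0" if "v \<in> tangent A p" for v
    using tangent_locally_const[OF that _ N(1,2)] N(4) by blast
  ultimately show ?thesis using that[of W y \<psi>] W(2,3) y N(2,4,5) \<psi> by simp
qed

text \<open>
  The chart which is chosen inside \<open>ext_d\<close> contains \<open>p\<close>, and every tangent vector at \<open>p\<close> has components
  in it.
\<close>

lemma ext_d_fn:
  assumes "f \<in> Cinf A" "v \<in> tangent A p"
  shows "ext_d A (fn f) p [v] = v f"
proof -
  define c where "c = (SOME c. c \<in> A \<and> p \<in> fst c)"
  have c: "c \<in> A" "p \<in> fst c"
    using chart_at[of p] someI_ex[of "\<lambda>c. c \<in> A \<and> p \<in> fst c"] unfolding c_def by metis+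
  have "ext_d A (fn f) p [v] = tvec A c p (coords A c p v) f"
    using assms by (simp add: ext_d_def fn_def tvec_apply Let_def flip: c_def)
  then show ?thesis using tvec_coords[OF c assms(2)] by simp
qed

section \<open>Vector fields\<close>

lemma vfields_tangent: "V \<in> vfields A \<Longrightarrow> V p \<in> tangent A p"
  by (simp add: vfields_def)

lemma vfields_coords:
  assumes "V \<in> vfields A" "c \<in> A"
  obtains a where "smooth_on (snd c ` fst c) a" "\<And>p. p \<in> fst c \<Longrightarrow> V p = tvec A c p (a (snd c p))"
  using assms unfolding vfields_def by blast

lemma vfields_add:
  assumes "U \<in> vfields A" "V \<in> vfields A" shows "U + V \<in> vfields A"
proof -
  have "\<exists>a. smooth_on (snd c ` fst c) a \<and> (\<forall>p\<in>fst c. (U + V) p = tvec A c p (a (snd c p)))"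
    if c: "c \<in> A" for c
  proof -
    obtain a b where "smooth_on (snd c ` fst c) a" "\<And>p. p \<in> fst c \<Longrightarrow> U p = tvec A c p (a (snd c p))"
     "smooth_on (snd c ` fst c) b" "\<And>p. p \<in> fst c \<Longrightarrow> V p = tvec A c p (b (snd c p))"
      using vfields_coords[OF assms(1) c] vfields_coords[OF assms(2) c] by metis
    then show ?thesis
      using smooth_on_add[OF open_chart_range[OF c]] tvec_add[OF c]
      by (intro exI[of _ "\<lambda>z. a z + b z"]) simp
  qed
  moreover have "(U + V) p \<in> tangent A p" for p
    using tangent_add vfields_tangent assms by simp
  ultimately show ?thesis unfolding vfields_def by blast
qed

lemma vfields_smul:
  assumes f: "f \<in> Cinf A" and "V \<in> vfields A" shows "smul_vf f V \<in> vfields A"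
proof -
  have "\<exists>a. smooth_on (snd c ` fst c) a \<and> (\<forall>p\<in>fst c. smul_vf f V p = tvec A c p (a (snd c p)))"
    if c: "c \<in> A" for c
  proof -
    obtain a where "smooth_on (snd c ` fst c) a" "\<And>p. p \<in> fst c \<Longrightarrow> V p = tvec A c p (a (snd c p))"
      using vfields_coords[OF assms(2) c] by metis
    then show ?thesis
      using smooth_on_scaleR[OF open_chart_range[OF c] Cinf_smooth[OF f c]] tvec_scale[OF c] c
      by (intro exI[of _ "\<lambda>z. f (chart_inv c z) *\<^sub>R a z"]) (simp add: smul_vf_def)
  qed
  moreover have "smul_vf f V p \<in> tangent A p" for p
    using tangent_scale[OF vfields_tangent[OF assms(2)]] by (simp add: smul_vf_def)
  ultimately show ?thesis unfolding vfields_def by simp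
qed

lemma vfields_zero: "0 \<in> vfields A"
proof -
  have z: "0 = tvec A c p 0" if "c \<in> A" "p \<in> fst c" for c p
    using linear_0[OF tvec_linear[OF that]] by (simp add: fun_eq_iff)
  then have "(0::'a vfield) p \<in> tangent A p" for p
    using tvec_tangent by (metis chart_at zero_fun_apply)
  moreover have "smooth_on (snd c ` fst c) (\<lambda>_. 0 :: real ^ 'n) \<and>
     (\<forall>p\<in>fst c. (0::'a vfield) p = tvec A c p 0)" if "c \<in> A" for c
    using z[OF that] smooth_on_const[OF open_chart_range[OF that]] by simp
  ultimately show ?thesis
    unfolding vfields_def by (auto intro!: exI[of _ "\<lambda>_. 0"])
qed

lemma vfields_sum: "(\<And>i. i \<in> I \<Longrightarrow> F i \<in> vfields A) \<Longrightarrow> (\<Sum>i\<in>I. F i) \<in> vfields A"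
proof (induction I rule: infinite_finite_induct)
  case (insert i I)
  have "F i + (\<Sum>i\<in>I. F i) \<in> vfields A"
    using insert by (intro vfields_add) blast+
  then show ?case by (simp only: sum.insert[OF insert.hyps])
next
  case (infinite I)
  show ?case unfolding sum.infinite[OF infinite(1)] by (rule vfields_zero)
next
  case empty
  show ?case unfolding sum.empty by (rule vfields_zero)
qed

section \<open>Differential forms\<close>

lemma forms_outside:
  "\<alpha> \<in> forms A n \<Longrightarrow> \<not> (length vs = n \<and> set vs \<subseteq> tangent A p) \<Longrightarrow> \<alpha> p vs = 0"
  unfolding forms_def by blast

lemma forms_add_arg:
  "\<alpha> \<in> forms A n \<Longrightarrow> length vs = n \<Longrightarrow> set vs \<subseteq> tangent A p \<Longrightarrow> i < n \<Longrightarrow>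
   v \<in> tangent A p \<Longrightarrow> w \<in> tangent A p \<Longrightarrow>
   \<alpha> p (vs[i := v + w]) = \<alpha> p (vs[i := v]) + \<alpha> p (vs[i := w])"
  by (simp add: forms_def)

lemma forms_scale_arg:
  "\<alpha> \<in> forms A n \<Longrightarrow> length vs = n \<Longrightarrow> set vs \<subseteq> tangent A p \<Longrightarrow> i < n \<Longrightarrow> v \<in> tangent A p \<Longrightarrow>
   \<alpha> p (vs[i := (\<lambda>f. r * v f)]) = r * \<alpha> p (vs[i := v])"
  by (simp add: forms_def)

lemma forms_alternating:
  "\<alpha> \<in> forms A n \<Longrightarrow> length vs = n \<Longrightarrow> set vs \<subseteq> tangent A p \<Longrightarrow> i < j \<Longrightarrow> j < n \<Longrightarrow>
   vs ! i = vs ! j \<Longrightarrow> \<alpha> p vs = 0"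
  unfolding forms_def by blast

lemma forms_smooth:
  "\<alpha> \<in> forms A n \<Longrightarrow> c \<in> A \<Longrightarrow> length is = n \<Longrightarrow>
   smooth_on (snd c ` fst c)
     (\<lambda>z. \<alpha> (chart_inv c z) (map (\<lambda>i. partial A c i (chart_inv c z)) is))"
  unfolding forms_def comp_def by blast

lemma formsI:
  assumes "\<And>p vs. \<not> (length vs = n \<and> set vs \<subseteq> tangent A p) \<Longrightarrow> \<alpha> p vs = 0"
    "\<And>p vs i v w. length vs = n \<Longrightarrow> set vs \<subseteq> tangent A p \<Longrightarrow> i < n \<Longrightarrow>
        v \<in> tangent A p \<Longrightarrow> w \<in> tangent A p \<Longrightarrow>
        \<alpha> p (vs[i := v + w]) = \<alpha> p (vs[i := v]) + \<alpha> p (vs[i := w])"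
    "\<And>p vs i v r. length vs = n \<Longrightarrow> set vs \<subseteq> tangent A p \<Longrightarrow> i < n \<Longrightarrow> v \<in> tangent A p \<Longrightarrow>
        \<alpha> p (vs[i := (\<lambda>f. r * v f)]) = r * \<alpha> p (vs[i := v])"
    "\<And>p vs i j. length vs = n \<Longrightarrow> set vs \<subseteq> tangent A p \<Longrightarrow> i < j \<Longrightarrow> j < n \<Longrightarrow> vs ! i = vs ! j \<Longrightarrow>
        \<alpha> p vs = 0"
    "\<And>c is. c \<in> A \<Longrightarrow> length is = n \<Longrightarrow> smooth_on (snd c ` fst c)
        (\<lambda>z. \<alpha> (chart_inv c z) (map (\<lambda>i. partial A c i (chart_inv c z)) is))"
  shows "\<alpha> \<in> forms A n"
  unfolding forms_def comp_def using assms by blast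

lemma forms_add:
  assumes "\<alpha> \<in> forms A n" "\<beta> \<in> forms A n" shows "\<alpha> + \<beta> \<in> forms A n"
proof (rule formsI)
  show "smooth_on (snd c ` fst c)
        (\<lambda>z. (\<alpha> + \<beta>) (chart_inv c z) (map (\<lambda>i. partial A c i (chart_inv c z)) is))"
    if "c \<in> A" "length is = n" for c "is"
    using smooth_on_add[OF open_chart_range[OF that(1)] forms_smooth[OF assms(1) that]
        forms_smooth[OF assms(2) that]] by simp
qed (use assms in \<open>simp_all add: forms_outside forms_add_arg forms_scale_arg forms_alternating
      algebra_simps del: de_Morgan_conj\<close>)

lemma forms_smul:
  assumes f: "f \<in> Cinf A" and "\<alpha> \<in> forms A n" shows "smul f \<alpha> \<in> forms A n"
proof (rule formsI)
  show "smooth_on (snd c ` fst c)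
        (\<lambda>z. smul f \<alpha> (chart_inv c z) (map (\<lambda>i. partial A c i (chart_inv c z)) is))"
    if "c \<in> A" "length is = n" for c "is"
    using smooth_on_mult[OF open_chart_range[OF that(1)] Cinf_smooth[OF f that(1)]
        forms_smooth[OF assms(2) that]] by (simp add: smul_def)
qed (use assms(2) in \<open>simp_all add: smul_def forms_outside forms_add_arg forms_scale_arg
      forms_alternating algebra_simps del: de_Morgan_conj\<close>)

lemma forms_zero: "0 \<in> forms A n"
  by (rule formsI) (simp_all add: smooth_on_const open_chart_range)

lemma forms_diff:
  assumes "\<alpha> \<in> forms A n" "\<beta> \<in> forms A n" shows "\<alpha> - \<beta> \<in> forms A n"
proof -
  have eq: "\<alpha> - \<beta> = \<alpha> + smul (\<lambda>_. -1) \<beta>" by (simp add: fun_eq_iff smul_def)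
  show ?thesis unfolding eq by (intro forms_add forms_smul Cinf_const assms)
qed

lemma forms_sum: "(\<And>i. i \<in> I \<Longrightarrow> F i \<in> forms A n) \<Longrightarrow> (\<Sum>i\<in>I. F i) \<in> forms A n"
  by (induction I rule: infinite_finite_induct) (auto intro: forms_add forms_zero)

lemma fn_form:
  assumes "f \<in> Cinf A" shows "fn f \<in> forms A 0"
  by (rule formsI) (auto simp: fn_def Cinf_smooth[OF assms])

lemma form0_Cinf:
  assumes "\<alpha> \<in> forms A 0" shows "(\<lambda>p. \<alpha> p []) \<in> Cinf A"
  by (rule CinfI) (use forms_smooth[OF assms, of _ "[]"] in simp)

lemma form0_eq: "\<alpha> \<in> forms A 0 \<Longrightarrow> fn (\<lambda>p. \<alpha> p []) = \<alpha>"
  using forms_outside[of \<alpha> 0] by (fastforce simp: fn_def)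

lemma form1_linear:
  assumes "\<tau> \<in> forms A 1" "c \<in> A" "p \<in> fst c"
  shows "linear (\<lambda>a. \<tau> p [tvec A c p a])"
proof (rule linearI)
  note t = tvec_tangent[OF assms(2,3)]
  show "\<tau> p [tvec A c p (a + b)] = \<tau> p [tvec A c p a] + \<tau> p [tvec A c p b]" for a b
    using forms_add_arg[OF assms(1), of "[tvec A c p a]" p 0 "tvec A c p a" "tvec A c p b"] t
    by (simp add: tvec_add[OF assms(2,3)])
  show "\<tau> p [tvec A c p (r *\<^sub>R a)] = r *\<^sub>R \<tau> p [tvec A c p a]" for r a
    using forms_scale_arg[OF assms(1), of "[tvec A c p a]" p 0 "tvec A c p a" r] t
    by (simp add: tvec_scale[OF assms(2,3)])
qed

lemma form2_linear_left:
  assumes "\<alpha> \<in> forms A 2" "c \<in> A" "p \<in> fst c" "w \<in> tangent A p"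
  shows "linear (\<lambda>a. \<alpha> p [tvec A c p a, w])"
proof (rule linearI)
  note t = tvec_tangent[OF assms(2,3)]
  show "\<alpha> p [tvec A c p (a + b), w] = \<alpha> p [tvec A c p a, w] + \<alpha> p [tvec A c p b, w]" for a b
    using forms_add_arg[OF assms(1), of "[w, w]" p 0 "tvec A c p a" "tvec A c p b"] t assms(4)
    by (simp add: tvec_add[OF assms(2,3)])
  show "\<alpha> p [tvec A c p (r *\<^sub>R a), w] = r *\<^sub>R \<alpha> p [tvec A c p a, w]" for r a
    using forms_scale_arg[OF assms(1), of "[w, w]" p 0 "tvec A c p a" r] t assms(4)
    by (simp add: tvec_scale[OF assms(2,3)])
qed

lemma form2_swap:
  assumes "\<alpha> \<in> forms A 2" "v \<in> tangent A p" "w \<in> tangent A p"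
  shows "\<alpha> p [w, v] = - \<alpha> p [v, w]"
proof -
  note a = forms_add_arg[OF assms(1), of _ p] and z = forms_alternating[OF assms(1), of _ p 0 1]
  have "0 = \<alpha> p [v + w, v + w]"
    using z[of "[v + w, v + w]"] tangent_add assms(2,3) by simp
  also have "\<dots> = \<alpha> p [v, v + w] + \<alpha> p [w, v + w]"
    using a[of "[v, v + w]" 0 v w] tangent_add assms(2,3) by simp
  also have "\<dots> = \<alpha> p [v, v] + \<alpha> p [v, w] + (\<alpha> p [w, v] + \<alpha> p [w, w])"
    using a[of "[v, v]" 1 v w] a[of "[w, w]" 1 v w] assms(2,3) by simp
  also have "\<dots> = \<alpha> p [v, w] + \<alpha> p [w, v]"
    using z[of "[v, v]"] z[of "[w, w]"] assms(2,3) by simp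
  finally show ?thesis by simp
qed

lemma form2_linear_right:
  assumes "\<alpha> \<in> forms A 2" "c \<in> A" "p \<in> fst c" "v \<in> tangent A p"
  shows "linear (\<lambda>a. \<alpha> p [v, tvec A c p a])"
proof -
  have "(\<lambda>a. \<alpha> p [v, tvec A c p a]) = (\<lambda>a. - \<alpha> p [tvec A c p a, v])"
    using form2_swap[OF assms(1) tvec_tangent[OF assms(2,3)] assms(4)] by simp
  then show ?thesis
    using linear_compose_neg[OF form2_linear_left[OF assms]] by simp
qed

lemma form1_expand:
  assumes "\<tau> \<in> forms A 1" "c \<in> A" "p \<in> fst c"
  shows "\<tau> p [tvec A c p a] = (\<Sum>i\<in>UNIV. a $ i * \<tau> p [partial A c i p])"
  unfolding partial_def by (rule linear_axis_expansion[OF form1_linear[OF assms]])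

lemma form2_expand_right:
  assumes "\<alpha> \<in> forms A 2" "c \<in> A" "p \<in> fst c" "v \<in> tangent A p"
  shows "\<alpha> p [v, tvec A c p a] = (\<Sum>i\<in>UNIV. a $ i * \<alpha> p [v, partial A c i p])"
  unfolding partial_def by (rule linear_axis_expansion[OF form2_linear_right[OF assms]])

lemma form2_expand_left:
  assumes "\<alpha> \<in> forms A 2" "c \<in> A" "p \<in> fst c" "w \<in> tangent A p"
  shows "\<alpha> p [tvec A c p a, w] = (\<Sum>i\<in>UNIV. a $ i * \<alpha> p [partial A c i p, w])"
  unfolding partial_def by (rule linear_axis_expansion[OF form2_linear_left[OF assms]])

lemma form2_expand:
  assumes "\<alpha> \<in> forms A 2" "c \<in> A" "p \<in> fst c"
  shows "\<alpha> p [tvec A c p a, tvec A c p b] =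
    (\<Sum>i\<in>UNIV. \<Sum>j\<in>UNIV. a $ i * b $ j * \<alpha> p [partial A c i p, partial A c j p])"
  by (simp add: form2_expand_left[OF assms tvec_tangent] form2_expand_right[OF assms partial_tangent]
      assms sum_distrib_left mult.assoc)

lemma form1_eval_Cinf:
  assumes "\<tau> \<in> forms A 1" "V \<in> vfields A"
  shows "(\<lambda>q. \<tau> q [V q]) \<in> Cinf A"
proof (rule CinfI)
  fix c assume c: "c \<in> A"
  note S = open_chart_range[OF c]
  obtain a where a: "smooth_on (snd c ` fst c) a" "\<And>p. p \<in> fst c \<Longrightarrow> V p = tvec A c p (a (snd c p))"
    using vfields_coords[OF assms(2) c] by metis
  have "smooth_on (snd c ` fst c)
      (\<lambda>z. \<Sum>i\<in>UNIV. a z $ i * \<tau> (chart_inv c z) [partial A c i (chart_inv c z)])"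
    using forms_smooth[OF assms(1) c, of "[_]"]
    by (intro smooth_on_sum smooth_on_mult S smooth_on_bounded_linear[OF bounded_linear_vec_nth] a)
      simp
  then show "smooth_on (snd c ` fst c) (\<lambda>z. \<tau> (chart_inv c z) [V (chart_inv c z)])"
    by (rule smooth_on_cong[OF S]) (use c in \<open>auto simp: a form1_expand[OF assms(1) c]\<close>)
qed

lemma form2_eval_Cinf:
  assumes "\<alpha> \<in> forms A 2" "V \<in> vfields A" "W \<in> vfields A"
  shows "(\<lambda>q. \<alpha> q [V q, W q]) \<in> Cinf A"
proof (rule CinfI)
  fix c assume c: "c \<in> A"
  note S = open_chart_range[OF c]
  obtain a where a: "smooth_on (snd c ` fst c) a" "\<And>p. p \<in> fst c \<Longrightarrow> V p = tvec A c p (a (snd c p))"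
    using vfields_coords[OF assms(2) c] by metis
  obtain b where b: "smooth_on (snd c ` fst c) b" "\<And>p. p \<in> fst c \<Longrightarrow> W p = tvec A c p (b (snd c p))"
    using vfields_coords[OF assms(3) c] by metis
  have "smooth_on (snd c ` fst c) (\<lambda>z. \<Sum>i\<in>UNIV. \<Sum>j\<in>UNIV. a z $ i * b z $ j *
      \<alpha> (chart_inv c z) [partial A c i (chart_inv c z), partial A c j (chart_inv c z)])"
    using forms_smooth[OF assms(1) c, of "[_, _]"]
    by (intro smooth_on_sum smooth_on_mult S smooth_on_bounded_linear[OF bounded_linear_vec_nth] a b)
      simp
  then show "smooth_on (snd c ` fst c) (\<lambda>z. \<alpha> (chart_inv c z) [V (chart_inv c z), W (chart_inv c z)])"
    by (rule smooth_on_cong[OF S]) (use c in \<open>auto simp: a b form2_expand[OF assms(1) c]\<close>)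
qed

lemma form1_ext:
  assumes "\<tau> \<in> forms A 1" "\<eta> \<in> forms A 1" "\<And>p v. v \<in> tangent A p \<Longrightarrow> \<tau> p [v] = \<eta> p [v]"
  shows "\<tau> = \<eta>"
proof (intro ext)
  fix p vs
  show "\<tau> p vs = \<eta> p vs"
  proof (cases "length vs = 1 \<and> set vs \<subseteq> tangent A p")
    case True
    then show ?thesis using assms(3) by (auto simp: length_Suc_conv)
  next
    case False
    then show ?thesis using forms_outside[OF assms(1)] forms_outside[OF assms(2)] by metis
  qed
qed

lemma form2_ext:
  assumes "\<alpha> \<in> forms A 2" "\<beta> \<in> forms A 2"
    "\<And>p v w. v \<in> tangent A p \<Longrightarrow> w \<in> tangent A p \<Longrightarrow> \<alpha> p [v, w] = \<beta> p [v, w]"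
  shows "\<alpha> = \<beta>"
proof (intro ext)
  fix p vs
  show "\<alpha> p vs = \<beta> p vs"
  proof (cases "length vs = 2 \<and> set vs \<subseteq> tangent A p")
    case True
    then show ?thesis using assms(3) by (auto simp: length_Suc_conv numeral_2_eq_2)
  next
    case False
    then show ?thesis using forms_outside[OF assms(1)] forms_outside[OF assms(2)] by metis
  qed
qed

end

section \<open>The wedge product\<close>

lemma nths_eq_Nil_iff: "nths xs I = [] \<longleftrightarrow> (\<forall>i\<in>I. \<not> i < length xs)"
proof -
  have "nths xs I = [] \<longleftrightarrow> set (nths xs I) = {}" by simp
  then show ?thesis unfolding set_nths by auto
qed

text \<open>
  A \<open>0\<close>-form vanishes on nonempty lists, so only the shuffle that passes no vector to it contributes.
\<close>

lemma wedge_fn_left: "wedge (fn f) \<alpha> = smul f \<alpha>"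
proof (intro ext)
  fix p and vs :: "'a tvec list"
  let ?t = "\<lambda>S. (-1) ^ card {(i, j). i \<in> S \<and> j < i \<and> j \<notin> S} * fn f p (nths vs S) * \<alpha> p (nths vs (- S))"
  have "?t S = (if S = {} then f p * \<alpha> p vs else 0)" if "S \<in> Pow {..<length vs}" for S
    using that by (auto simp: fn_def nths_eq_Nil_iff nths_all)
  then have "wedge (fn f) \<alpha> p vs = (\<Sum>S\<in>Pow {..<length vs}. if S = {} then f p * \<alpha> p vs else 0)"
    unfolding wedge_def by (intro sum.cong) auto
  then show "wedge (fn f) \<alpha> p vs = smul f \<alpha> p vs"
    by (simp add: smul_def)
qed

lemma wedge_fn_right: "wedge \<alpha> (fn f) = smul f \<alpha>"
proof (intro ext)
  fix p and vs :: "'a tvec list"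
  let ?n = "{..<length vs}"
  let ?t = "\<lambda>S. (-1) ^ card {(i, j). i \<in> S \<and> j < i \<and> j \<notin> S} * \<alpha> p (nths vs S) * fn f p (nths vs (- S))"
  have "{(i, j). i \<in> ?n \<and> j < i \<and> j \<notin> ?n} = {}" by auto
  moreover have "nths vs ?n = vs" by (simp add: nths_all)
  moreover have "nths vs (- ?n) = []" by (simp add: nths_eq_Nil_iff)
  ultimately have n: "?t ?n = f p * \<alpha> p vs" by (simp only: fn_def) simp
  have "?t S = 0" if "S \<subseteq> ?n" "S \<noteq> ?n" for S
    using that by (auto simp: fn_def nths_eq_Nil_iff)
  then have "?t S = (if S = ?n then f p * \<alpha> p vs else 0)" if "S \<in> Pow ?n" for S
    using n that by auto
  then have "wedge \<alpha> (fn f) p vs = (\<Sum>S\<in>Pow ?n. if S = ?n then f p * \<alpha> p vs else 0)"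
    unfolding wedge_def by (intro sum.cong) auto
  then show "wedge \<alpha> (fn f) p vs = smul f \<alpha> p vs"
    by (simp add: smul_def)
qed

lemma wedge_1_1:
  assumes "\<tau> p [] = 0" "\<eta> p [] = 0"
  shows "wedge \<tau> \<eta> p [v, w] = \<tau> p [v] * \<eta> p [w] - \<tau> p [w] * \<eta> p [v]"
proof -
  have P: "Pow {..<length [v, w]} = {{}, {0}, {1}, {0, 1}}"
    by (auto simp: lessThan_Suc Pow_insert)
  have "{(i, j). i \<in> {1::nat} \<and> j < i \<and> j \<notin> {1}} = {(1, 0)}" by auto
  then have c1: "card {(i, j). i \<in> {1::nat} \<and> j < i \<and> j \<notin> {1}} = 1" by simp
  have "{(i, j). i \<in> {0::nat} \<and> j < i \<and> j \<notin> {0}} = {}" by auto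
  then have c0: "card {(i, j). i \<in> {0::nat} \<and> j < i \<and> j \<notin> {0}} = 0" by (simp only: card.empty)
  have n: "nths [v, w] {} = []" "nths [v, w] {0} = [v]" "nths [v, w] {1} = [w]"
    "nths [v, w] (- {0, 1}) = []" "nths [v, w] (- {0}) = [w]" "nths [v, w] (- {1}) = [v]"
    by (simp_all add: nths_Cons)
  define t where "t S = (-1) ^ card {(i, j). i \<in> S \<and> j < i \<and> j \<notin> S} *
    \<tau> p (nths [v, w] S) * \<eta> p (nths [v, w] (- S))" for S
  have "t {} = 0" "t {0, 1} = 0"
    unfolding t_def n assms by simp_all
  moreover have "t {0} = \<tau> p [v] * \<eta> p [w]" "t {1} = - \<tau> p [w] * \<eta> p [v]"
    unfolding t_def n c0 c1 by simp_all
  moreover have "wedge \<tau> \<eta> p [v, w] = (\<Sum>S\<in>{{}, {0}, {1}, {0, 1}}. t S)"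
    unfolding wedge_def t_def P ..
  moreover have "(\<Sum>S\<in>{{}, {0}, {1}, {0, 1}}. t S) = t {} + t {0} + t {1} + t {0, 1}"
    by (simp add: doubleton_eq_iff)
  ultimately show ?thesis by simp
qed

lemma wedge_diff_left: "wedge (\<alpha> - \<alpha>') \<beta> = wedge \<alpha> \<beta> - wedge \<alpha>' \<beta>"
  and wedge_diff_right: "wedge \<alpha> (\<beta> - \<beta>') = wedge \<alpha> \<beta> - wedge \<alpha> \<beta>'"
  and wedge_zero_left: "wedge 0 \<beta> = 0"
  and wedge_zero_right: "wedge \<alpha> 0 = 0"
  by (auto simp: wedge_def fun_eq_iff algebra_simps sum_subtractf)

section \<open>First-order terms of a deformation\<close>

lemma hprod_const_right_nth_1:
  "fps_nth (hprod P F (fps_const \<gamma>)) 1 =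
    fps_nth (P (fps_nth F 0) \<gamma>) 1 + fps_nth (P (fps_nth F 0) 0) 0 + fps_nth (P (fps_nth F 1) \<gamma>) 0"
  by (simp add: hprod_def atMost_Suc add_ac)

lemma hprod_const_left_nth_1:
  "fps_nth (hprod P (fps_const \<alpha>) G) 1 =
    fps_nth (P \<alpha> (fps_nth G 0)) 1 + fps_nth (P \<alpha> (fps_nth G 1)) 0 + fps_nth (P 0 (fps_nth G 0)) 0"
  by (simp add: hprod_def atMost_Suc add_ac)

lemma hmap_nth_1: "fps_nth (hmap D F) 1 = fps_nth (D (fps_nth F 0)) 1 + fps_nth (D (fps_nth F 1)) 0"
  by (simp add: hmap_def atMost_Suc add_ac)

lemma hscale_1: "hscale 1 F = F"
  by (simp add: hscale_def smul_def fps_eq_iff)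

locale deformed_manifold = smooth_manifold A + formal_deformation A P D
  for A :: "('a::{t2_space, second_countable_topology}, 'n::finite) chart set"
    and P :: "'a form \<Rightarrow> 'a form \<Rightarrow> 'a form fps"
    and D :: "'a form \<Rightarrow> 'a form fps"
begin

text \<open>
  The classical operations are the constant terms of the deformed ones. This also yields closure of
  forms under \<open>wedge\<close> and \<open>ext_d\<close>, since all coefficients of the deformed operations are forms.
\<close>

lemma prod_nth_0: "\<alpha> \<in> forms A m \<Longrightarrow> \<beta> \<in> forms A n \<Longrightarrow> fps_nth (P \<alpha> \<beta>) 0 = wedge \<alpha> \<beta>"
  using prod_classical by (fastforce simp: bigO_h_def)

lemma d_nth_0: "\<alpha> \<in> forms A n \<Longrightarrow> fps_nth (D \<alpha>) 0 = ext_d A \<alpha>"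
  using d_classical by (fastforce simp: bigO_h_def)

lemma wedge_form: "\<alpha> \<in> forms A m \<Longrightarrow> \<beta> \<in> forms A n \<Longrightarrow> wedge \<alpha> \<beta> \<in> forms A (m + n)"
  using prod_forms prod_nth_0 by metis

lemma ext_d_form: "\<alpha> \<in> forms A n \<Longrightarrow> ext_d A \<alpha> \<in> forms A (Suc n)"
  using d_forms d_nth_0 by metis

lemma ext_d_add:
  assumes "\<alpha> \<in> forms A n" "\<beta> \<in> forms A n"
  shows "ext_d A (\<alpha> + \<beta>) = ext_d A \<alpha> + ext_d A \<beta>"
  using d_add[OF assms] by (simp flip: d_nth_0[OF assms(1)] d_nth_0[OF assms(2)] d_nth_0[OF forms_add[OF assms]])

lemma d_fn_form: "f \<in> Cinf A \<Longrightarrow> ext_d A (fn f) \<in> forms A 1"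
  using ext_d_form[OF fn_form] by simp

text \<open>
  The coefficient of \<open>\<hbar>\<close> in the associativity condition: the first-order part of the product is a
  Hochschild \<open>2\<close>-cocycle for the wedge product.
\<close>

lemma associator_nth_1:
  assumes "\<alpha> \<in> forms A l" "\<beta> \<in> forms A m" "\<gamma> \<in> forms A n"
  shows "fps_nth (P (wedge \<alpha> \<beta>) \<gamma>) 1 + wedge (fps_nth (P \<alpha> \<beta>) 1) \<gamma> =
         fps_nth (P \<alpha> (wedge \<beta> \<gamma>)) 1 + wedge \<alpha> (fps_nth (P \<beta> \<gamma>) 1)"
proof -
  have "fps_nth (hprod P (P \<alpha> \<beta>) (fps_const \<gamma>)) 1 = fps_nth (hprod P (fps_const \<alpha>) (P \<beta> \<gamma>)) 1"
    using wedge_assoc[OF assms] by (simp add: bigO_h_def)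
  moreover have "fps_nth (P (wedge \<alpha> \<beta>) 0) 0 = 0"
    using prod_nth_0[OF wedge_form[OF assms(1,2)] forms_zero[of n]] by (simp add: wedge_zero_right)
  moreover have "fps_nth (P 0 (wedge \<beta> \<gamma>)) 0 = 0"
    using prod_nth_0[OF forms_zero[of l] wedge_form[OF assms(2,3)]] by (simp add: wedge_zero_left)
  moreover have "fps_nth (P (fps_nth (P \<alpha> \<beta>) 1) \<gamma>) 0 = wedge (fps_nth (P \<alpha> \<beta>) 1) \<gamma>"
    using prod_nth_0[OF prod_forms[OF assms(1,2)] assms(3)] .
  moreover have "fps_nth (P \<alpha> (fps_nth (P \<beta> \<gamma>) 1)) 0 = wedge \<alpha> (fps_nth (P \<beta> \<gamma>) 1)"
    using prod_nth_0[OF assms(1) prod_forms[OF assms(2,3)]] .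
  ultimately show ?thesis
    unfolding hprod_const_right_nth_1 hprod_const_left_nth_1 prod_nth_0[OF assms(1,2)]
      prod_nth_0[OF assms(2,3)] by simp
qed

lemma gam_form:
  assumes "x \<in> Cinf A" "\<alpha> \<in> forms A n" shows "gam P x \<alpha> \<in> forms A n"
  using forms_diff prod_forms[OF fn_form[OF assms(1)] assms(2)] prod_forms[OF assms(2) fn_form[OF assms(1)]]
  by (simp add: gam_def)

lemma gam_add:
  assumes "x \<in> Cinf A" "\<alpha> \<in> forms A n" "\<beta> \<in> forms A n"
  shows "gam P x (\<alpha> + \<beta>) = gam P x \<alpha> + gam P x \<beta>"
  using prod_add_right[OF fn_form[OF assms(1)] assms(2,3)] prod_add_left[OF assms(2,3) fn_form[OF assms(1)]]
  by (simp add: gam_def)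

text \<open>
  The alternating sum of the cocycle identities for \<open>(x, \<alpha>, \<beta>)\<close>, \<open>(\<alpha>, x, \<beta>)\<close> and \<open>(\<alpha>, \<beta>, x)\<close>; the terms
  in which \<open>x\<close> multiplies a form classically cancel because functions commute with forms.
\<close>

lemma gam_wedge:
  assumes "x \<in> Cinf A" "\<alpha> \<in> forms A m" "\<beta> \<in> forms A n"
  shows "gam P x (wedge \<alpha> \<beta>) = wedge (gam P x \<alpha>) \<beta> + wedge \<alpha> (gam P x \<beta>)"
proof (intro ext)
  fix p vs
  note assoc = associator_nth_1[OF fn_form[OF assms(1)] assms(2,3)]
    associator_nth_1[OF assms(2) fn_form[OF assms(1)] assms(3)]
    associator_nth_1[OF assms(2,3) fn_form[OF assms(1)]]
  show "gam P x (wedge \<alpha> \<beta>) p vs = (wedge (gam P x \<alpha>) \<beta> + wedge \<alpha> (gam P x \<beta>)) p vs"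
    using assoc[THEN fun_cong[of _ _ p], THEN fun_cong[of _ _ vs]]
    by (simp add: gam_def wedge_diff_left wedge_diff_right wedge_fn_left wedge_fn_right)
qed

lemma commutator_bigO:
  assumes "x \<in> Cinf A" "\<alpha> \<in> forms A n"
  shows "bigO_h 2 (P (fn x) \<alpha> - P \<alpha> (fn x)) \<longleftrightarrow> gam P x \<alpha> = 0"
proof -
  have "fps_nth (P (fn x) \<alpha> - P \<alpha> (fn x)) 0 = 0"
    using prod_nth_0[OF fn_form[OF assms(1)] assms(2)] prod_nth_0[OF assms(2) fn_form[OF assms(1)]]
    by (simp add: wedge_fn_left wedge_fn_right)
  then show ?thesis
    unfolding bigO_h_def gam_def by (auto simp: less_2_cases_iff)
qed

lemma poisson_gam:
  assumes "x \<in> Cinf A" "y \<in> Cinf A"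
  shows "fn (poisson P x y) = gam P x (fn y)"
  using form0_eq[OF gam_form[OF assms(1) fn_form[OF assms(2)]]] by (simp add: gam_def poisson_def)

lemma poisson_Cinf:
  assumes "x \<in> Cinf A" "y \<in> Cinf A" shows "poisson P x y \<in> Cinf A"
  using form0_Cinf[OF gam_form[OF assms(1) fn_form[OF assms(2)]]] by (simp add: gam_def poisson_def)

lemma poisson_antisym: "poisson P y x p = - poisson P x y p"
  by (simp add: poisson_def)

lemma gam_smul:
  assumes "x \<in> Cinf A" "f \<in> Cinf A" "\<alpha> \<in> forms A n"
  shows "gam P x (smul f \<alpha>) = smul (poisson P x f) \<alpha> + smul f (gam P x \<alpha>)"
  using gam_wedge[OF assms(1) fn_form[OF assms(2)] assms(3)]
  by (simp add: wedge_fn_left flip: poisson_gam[OF assms(1,2)])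

text \<open>
  Subtract the first-order Leibniz rules for \<open>x \<bullet> y\<close> and \<open>y \<bullet> x\<close>. The terms with the first-order
  part of \<open>D\<close> are symmetric in \<open>x\<close> and \<open>y\<close> and cancel.
\<close>

lemma d_poisson:
  assumes x: "x \<in> Cinf A" and y: "y \<in> Cinf A"
  shows "ext_d A (fn (poisson P x y)) = gam P x (ext_d A (fn y)) - gam P y (ext_d A (fn x))"
proof -
  have L: "fps_nth (D (wedge (fn x) (fn y))) 1 + ext_d A (fps_nth (P (fn x) (fn y)) 1) =
      fps_nth (P (ext_d A (fn x)) (fn y)) 1 + wedge (fps_nth (D (fn x)) 1) (fn y) +
      (fps_nth (P (fn x) (ext_d A (fn y))) 1 + wedge (fn x) (fps_nth (D (fn y)) 1))"
    if "x \<in> Cinf A" "y \<in> Cinf A" for x y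
  proof -
    note x = fn_form[OF that(1)] and y = fn_form[OF that(2)]
    have "bigO_h 2 (hmap D (P (fn x) (fn y)) -
        (hprod P (D (fn x)) (fps_const (fn y)) + hprod P (fps_const (fn x)) (D (fn y))))"
      using d_leibniz[OF x y] by (simp only: power_0 hscale_1)
    then have "fps_nth (hmap D (P (fn x) (fn y)) -
        (hprod P (D (fn x)) (fps_const (fn y)) + hprod P (fps_const (fn x)) (D (fn y)))) 1 = 0"
      unfolding bigO_h_def by fastforce
    then have "fps_nth (hmap D (P (fn x) (fn y))) 1 =
        fps_nth (hprod P (D (fn x)) (fps_const (fn y))) 1 + fps_nth (hprod P (fps_const (fn x)) (D (fn y))) 1"
      by (simp only: fps_sub_nth fps_add_nth right_minus_eq)
    moreover have "fps_nth (P (ext_d A (fn x)) 0) 0 = 0" "fps_nth (P 0 (ext_d A (fn y))) 0 = 0"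
      using prod_nth_0[OF ext_d_form[OF x] forms_zero[of 0]] prod_nth_0[OF forms_zero[of 0] ext_d_form[OF y]]
      by (simp_all add: wedge_zero_left wedge_zero_right)
    moreover have "fps_nth (P (fps_nth (D (fn x)) 1) (fn y)) 0 = wedge (fps_nth (D (fn x)) 1) (fn y)"
      "fps_nth (P (fn x) (fps_nth (D (fn y)) 1)) 0 = wedge (fn x) (fps_nth (D (fn y)) 1)"
      using prod_nth_0[OF d_forms[OF x] y] prod_nth_0[OF x d_forms[OF y]] by auto
    moreover have "fps_nth (D (fps_nth (P (fn x) (fn y)) 1)) 0 = ext_d A (fps_nth (P (fn x) (fn y)) 1)"
      using d_nth_0[OF prod_forms[OF x y]] .
    ultimately show ?thesis
      unfolding hprod_const_right_nth_1 hprod_const_left_nth_1 hmap_nth_1 prod_nth_0[OF x y]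
        d_nth_0[OF x] d_nth_0[OF y] by simp
  qed
  have "fps_nth (P (fn x) (fn y)) 1 = fn (poisson P x y) + fps_nth (P (fn y) (fn x)) 1"
    unfolding poisson_gam[OF x y] by (simp add: gam_def)
  moreover have "fps_nth (P (fn y) (fn x)) 1 \<in> forms A 0" "fn (poisson P x y) \<in> forms A 0"
    using prod_forms[OF fn_form[OF y] fn_form[OF x]] fn_form[OF poisson_Cinf[OF x y]] by auto
  ultimately have S: "ext_d A (fps_nth (P (fn x) (fn y)) 1) =
      ext_d A (fn (poisson P x y)) + ext_d A (fps_nth (P (fn y) (fn x)) 1)"
    using ext_d_add by simp
  have W: "wedge (fn y) (fn x) = wedge (fn x) (fn y)"
    using wedge_fn_left[of x "fn y"] wedge_fn_right[of "fn y" x] by metis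
  show ?thesis
  proof (intro ext)
    fix p vs
    have "fps_nth (D (wedge (fn y) (fn x))) 1 p vs = fps_nth (D (wedge (fn x) (fn y))) 1 p vs"
      by (simp only: W)
    then show "ext_d A (fn (poisson P x y)) p vs =
        (gam P x (ext_d A (fn y)) - gam P y (ext_d A (fn x))) p vs"
      using L[OF x y, THEN fun_cong[of _ _ p], THEN fun_cong[of _ _ vs]]
        L[OF y x, THEN fun_cong[of _ _ p], THEN fun_cong[of _ _ vs]]
        S[THEN fun_cong[of _ _ p], THEN fun_cong[of _ _ vs]]
      by (simp add: gam_def wedge_fn_left wedge_fn_right)
  qed
qed

section \<open>Local decompositions of forms\<close>

text \<open>
  The coefficients are \<open>g j = \<psi> \<tau>(\<partial>/\<partial>x\<^sup>j)\<close>, extended by zero. The cutoff is the same for all \<open>\<tau>\<close>, so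
  that operators on \<open>1\<close>-forms which are linear over functions can be compared through finitely many
  exact forms.
\<close>

lemma form1_decomposition:
  assumes c: "c \<in> A" and p: "p \<in> fst c"
  obtains \<psi> and y :: "'n \<Rightarrow> 'a \<Rightarrow> real" where "\<psi> \<in> Cinf A" "\<psi> p = 1"
    "\<And>v. v \<in> tangent A p \<Longrightarrow> v \<psi> = 0" "\<And>j. y j \<in> Cinf A"
    "\<And>\<tau>. \<tau> \<in> forms A 1 \<Longrightarrow> \<exists>g. (\<forall>j. g j \<in> Cinf A \<and> g j p = \<tau> p [partial A c j p]) \<and>
        smul \<psi> \<tau> = (\<Sum>j\<in>UNIV. smul (g j) (ext_d A (fn (y j))))"
proof -
  obtain W and y :: "'n \<Rightarrow> 'a \<Rightarrow> real" and \<psi> where W: "p \<in> W" "W \<subseteq> fst c"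
    and y: "\<forall>j. y j \<in> Cinf A" "\<forall>q\<in>W. \<forall>a j. tvec A c q a (y j) = a $ j"
    and \<psi>: "\<psi> \<in> Cinf A" "\<psi> p = 1" "\<forall>v\<in>tangent A p. v \<psi> = 0" "\<forall>q. q \<notin> W \<longrightarrow> \<psi> q = 0"
    and extend: "\<forall>g. smooth_on (snd c ` fst c) g \<longrightarrow> (\<lambda>q. \<psi> q * g (snd c q)) \<in> Cinf A"
    by (rule cutoff_coordinates[OF c p])
  note y = y[rule_format] and \<psi> = \<psi>[rule_format]
  have "\<exists>g. (\<forall>j. g j \<in> Cinf A \<and> g j p = \<tau> p [partial A c j p]) \<and>
        smul \<psi> \<tau> = (\<Sum>j\<in>UNIV. smul (g j) (ext_d A (fn (y j))))" if \<tau>: "\<tau> \<in> forms A 1" for \<tau>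
  proof -
    define g where "g j q = \<psi> q * \<tau> (chart_inv c (snd c q)) [partial A c j (chart_inv c (snd c q))]" for j q
    have g: "g j \<in> Cinf A" for j
      unfolding g_def by (rule extend[rule_format]) (use forms_smooth[OF \<tau> c, of "[j]"] in simp)
    have gq: "g j q = \<psi> q * \<tau> q [partial A c j q]" for j q
      using c W(2) \<psi>(4)[of q] by (cases "q \<in> W") (auto simp: g_def)
    have "smul \<psi> \<tau> = (\<Sum>j\<in>UNIV. smul (g j) (ext_d A (fn (y j))))"
    proof (rule form1_ext)
      show "smul \<psi> \<tau> \<in> forms A 1" using forms_smul[OF \<psi>(1) \<tau>] .
      show "(\<Sum>j\<in>UNIV. smul (g j) (ext_d A (fn (y j)))) \<in> forms A 1"
        by (intro forms_sum forms_smul g d_fn_form y(1))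
      fix q v assume v: "v \<in> tangent A q"
      show "smul \<psi> \<tau> q [v] = (\<Sum>j\<in>UNIV. smul (g j) (ext_d A (fn (y j)))) q [v]"
      proof (cases "q \<in> W")
        case True
        then have q: "q \<in> fst c" using W(2) by blast
        obtain a where a: "v = tvec A c q a" using v tangent_eq[OF c q] by blast
        have "(\<Sum>j\<in>UNIV. smul (g j) (ext_d A (fn (y j)))) q [v]
            = (\<Sum>j\<in>UNIV. \<psi> q * \<tau> q [partial A c j q] * a $ j)"
          using v by (simp add: sum_fun_apply smul_def gq ext_d_fn[OF y(1)]) (simp add: a y(2)[OF True])
        then show ?thesis
          unfolding a form1_expand[OF \<tau> c q] by (simp add: smul_def sum_distrib_left mult_ac form1_expand[OF \<tau> c q])
      next
        case False
        then show ?thesis by (simp add: sum_fun_apply smul_def gq \<psi>(4))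
      qed
    qed
    then show ?thesis using g gq \<psi>(2) by (intro exI[of _ g]) simp
  qed
  note main = this
  show ?thesis
    by (rule that[of \<psi> y]) (rule \<psi> main y(1) | assumption)+
qed

text \<open>
  Locally \<open>\<alpha> = \<Sum>\<^sub>j \<tau>\<^sub>j \<and> dx\<^sup>j\<close> with \<open>\<tau>\<^sub>j(v) = \<alpha>(v, \<partial>/\<partial>x\<^sup>j) / 2\<close>; the factor \<open>1/2\<close> compensates that
  the wedge product antisymmetrises.
\<close>

lemma form2_decomposition:
  assumes \<alpha>: "\<alpha> \<in> forms A 2"
  obtains \<psi> and \<tau> \<sigma> :: "'n \<Rightarrow> 'a form" where "\<psi> \<in> Cinf A" "\<psi> p = 1"
    "\<And>v. v \<in> tangent A p \<Longrightarrow> v \<psi> = 0" "\<And>j. \<tau> j \<in> forms A 1" "\<And>j. \<sigma> j \<in> forms A 1"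
    "smul \<psi> \<alpha> = (\<Sum>j\<in>UNIV. wedge (\<tau> j) (\<sigma> j))"
proof -
  obtain c where c: "c \<in> A" and p: "p \<in> fst c" by (rule chart_at)
  obtain W and y :: "'n \<Rightarrow> 'a \<Rightarrow> real" and \<psi> where W: "p \<in> W" "W \<subseteq> fst c"
    and y: "\<forall>j. y j \<in> Cinf A" "\<forall>q\<in>W. \<forall>a j. tvec A c q a (y j) = a $ j"
    and \<psi>: "\<psi> \<in> Cinf A" "\<psi> p = 1" "\<forall>v\<in>tangent A p. v \<psi> = 0" "\<forall>q. q \<notin> W \<longrightarrow> \<psi> q = 0"
    and extend: "\<forall>g. smooth_on (snd c ` fst c) g \<longrightarrow> (\<lambda>q. \<psi> q * g (snd c q)) \<in> Cinf A"
    by (rule cutoff_coordinates[OF c p])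
  note y = y[rule_format] and \<psi> = \<psi>[rule_format]
  define g where "g i j q = \<psi> q * (1 / 2 * \<alpha> (chart_inv c (snd c q))
      [partial A c i (chart_inv c (snd c q)), partial A c j (chart_inv c (snd c q))])" for i j q
  have g: "g i j \<in> Cinf A" for i j
    unfolding g_def using forms_smooth[OF \<alpha> c, of "[i, j]"]
    by (intro extend[rule_format] smooth_on_mult smooth_on_const open_chart_range[OF c]) simp
  have gq: "g i j q = \<psi> q * (1 / 2 * \<alpha> q [partial A c i q, partial A c j q])" for i j q
    using c W(2) \<psi>(4)[of q] by (cases "q \<in> W") (auto simp: g_def)
  let ?d = "\<lambda>j. ext_d A (fn (y j))"
  define \<tau> where "\<tau> j = (\<Sum>i\<in>UNIV. smul (g i j) (?d i))" for j
  have \<tau>: "\<tau> j \<in> forms A 1" for j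
    unfolding \<tau>_def by (intro forms_sum forms_smul g d_fn_form y(1))
  have "smul \<psi> \<alpha> = (\<Sum>j\<in>UNIV. wedge (\<tau> j) (?d j))"
  proof (rule form2_ext)
    show "smul \<psi> \<alpha> \<in> forms A 2" using forms_smul[OF \<psi>(1) \<alpha>] .
    show "(\<Sum>j\<in>UNIV. wedge (\<tau> j) (?d j)) \<in> forms A 2"
      using wedge_form[OF \<tau> d_fn_form[OF y(1)]] by (intro forms_sum) (simp add: numeral_2_eq_2)
    fix q v w assume v: "v \<in> tangent A q" and w: "w \<in> tangent A q"
    have wq: "wedge (\<tau> j) (?d j) q [v, w] = \<tau> j q [v] * w (y j) - \<tau> j q [w] * v (y j)" for j
      using forms_outside[OF \<tau>, of "[]"] forms_outside[OF d_fn_form[OF y(1)], of "[]"] v w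
      by (simp add: wedge_1_1 ext_d_fn[OF y(1)])
    show "smul \<psi> \<alpha> q [v, w] = (\<Sum>j\<in>UNIV. wedge (\<tau> j) (?d j)) q [v, w]"
    proof (cases "q \<in> W")
      case True
      then have q: "q \<in> fst c" using W(2) by blast
      have \<tau>q: "\<tau> j q [u] = \<psi> q / 2 * \<alpha> q [u, partial A c j q]" if u: "u \<in> tangent A q" for u j
      proof -
        obtain a where a: "u = tvec A c q a" using u tangent_eq[OF c q] by blast
        have "\<tau> j q [u] = (\<Sum>i\<in>UNIV. g i j q * a $ i)"
          using u by (simp add: \<tau>_def sum_fun_apply smul_def ext_d_fn[OF y(1)]) (simp add: a y(2)[OF True])
        also have "\<dots> = \<psi> q / 2 * (\<Sum>i\<in>UNIV. a $ i * \<alpha> q [partial A c i q, partial A c j q])"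
          by (simp add: gq sum_distrib_left mult_ac)
        finally show ?thesis
          unfolding a form2_expand_left[OF \<alpha> c q partial_tangent[OF c q]] .
      qed
      have s: "(\<Sum>j\<in>UNIV. \<tau> j q [u] * u' (y j)) = \<psi> q / 2 * \<alpha> q [u, u']"
        if u: "u \<in> tangent A q" "u' \<in> tangent A q" for u u'
      proof -
        obtain b where b: "u' = tvec A c q b" using u tangent_eq[OF c q] by blast
        show ?thesis
          unfolding b form2_expand_right[OF \<alpha> c q u(1)] y(2)[OF True] \<tau>q[OF u(1)]
          by (simp add: sum_distrib_left mult_ac)
      qed
      have "(\<Sum>j\<in>UNIV. wedge (\<tau> j) (?d j)) q [v, w] = \<psi> q / 2 * \<alpha> q [v, w] - \<psi> q / 2 * \<alpha> q [w, v]"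
        by (simp add: sum_fun_apply wq sum_subtractf s v w)
      then show ?thesis
        unfolding form2_swap[OF \<alpha> v w] by (simp add: smul_def)
    next
      case False
      then have "\<tau> j q [u] = 0" for j u
        by (simp add: \<tau>_def sum_fun_apply smul_def gq \<psi>(4))
      then show ?thesis by (simp add: sum_fun_apply smul_def wq \<psi>(4)[OF False])
    qed
  qed
  note main = this
  show ?thesis
    by (rule that[of \<psi> \<tau> ?d]) (rule \<psi> main \<tau> d_fn_form[OF y(1)] | assumption)+
qed

end

section \<open>Hamiltonian vector fields and the symplectic form\<close>

lemma matrix_inv_left: "invertible M \<Longrightarrow> matrix_inv M ** M = mat 1"
  and matrix_inv_right: "invertible M \<Longrightarrow> M ** matrix_inv M = mat 1"
  for M :: "real ^ 'n::finite ^ 'n"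
  unfolding invertible_def matrix_inv_def by (metis (mono_tags, lifting) someI_ex)+

locale symplectic_deformation = deformed_manifold A P D
  for A :: "('a::{t2_space, second_countable_topology}, 'n::finite) chart set"
    and P :: "'a form \<Rightarrow> 'a form \<Rightarrow> 'a form fps"
    and D :: "'a form \<Rightarrow> 'a form fps" +
  fixes \<omega> :: "'a form"
  assumes nondegenerate: "nondegenerate_poisson A P"
    and symplectic: "symplectic_form A P \<omega>"
begin

abbreviation ham where "ham \<equiv> ham_field A P"

lemma ham_apply: "f \<in> Cinf A \<Longrightarrow> ham y p f = poisson P y f p"
  by (simp add: ham_field_def)

text \<open>
  On coordinate functions the bracket reads off the entries of its matrix, which therefore inherits
  the antisymmetry of the bracket.
\<close>

lemma poisson_matrix:
  assumes "c \<in> A" "p \<in> fst c"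
  obtains M where "poisson_matrix_at A P c p M" "invertible M" "transpose M = - M"
proof -
  obtain M where M: "poisson_matrix_at A P c p M" "invertible M"
    using nondegenerate assms unfolding nondegenerate_poisson_def by blast
  obtain W and y :: "'n \<Rightarrow> 'a \<Rightarrow> real" where W: "open W" "p \<in> W" "W \<subseteq> fst c" and y: "\<And>j. y j \<in> Cinf A"
    "\<And>q a j. q \<in> W \<Longrightarrow> tvec A c q a (y j) = a $ j"
    by (rule local_coordinates[OF assms], rule that) (assumption | blast)+
  have "M $ i $ j = poisson P (y i) (y j) p" for i j
  proof -
    have "poisson P (y i) (y j) p =
        (\<Sum>k\<in>UNIV. \<Sum>l\<in>UNIV. M $ k $ l * axis k 1 $ i * axis l 1 $ j)"
      using M(1) y W(2) by (simp add: poisson_matrix_at_def partial_def)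
    also have "\<dots> = (\<Sum>k\<in>UNIV. \<Sum>l\<in>UNIV. if l = j then if k = i then M $ k $ l else 0 else 0)"
      by (intro sum.cong) (auto simp: axis_def)
    also have "\<dots> = M $ i $ j"
      by (simp only: sum.delta finite UNIV_I if_True)
    finally show ?thesis by simp
  qed
  then have "transpose M $ i $ j = (- M) $ i $ j" for i j
    using poisson_antisym[of "y j" "y i" p] by (simp add: transpose_def)
  then have "transpose M = - M"
    by (subst vec_eq_iff) (subst vec_eq_iff, blast)
  then show ?thesis using that M by blast
qed

lemma ham_tvec:
  assumes M: "poisson_matrix_at A P c p M" and c: "c \<in> A" "p \<in> fst c" and y: "y \<in> Cinf A"
  shows "ham y p = tvec A c p ((\<chi> i. partial A c i p y) v* M)"
proof
  fix f
  show "ham y p f = tvec A c p ((\<chi> i. partial A c i p y) v* M) f"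
  proof (cases "f \<in> Cinf A")
    case True
    have "ham y p f = (\<Sum>i\<in>UNIV. \<Sum>j\<in>UNIV. M $ i $ j * partial A c i p y * partial A c j p f)"
      using M y True by (simp add: ham_apply poisson_matrix_at_def)
    also have "\<dots> = (\<Sum>j\<in>UNIV. \<Sum>i\<in>UNIV. M $ i $ j * partial A c i p y * partial A c j p f)"
      by (rule sum.swap)
    also have "\<dots> = tvec A c p ((\<chi> i. partial A c i p y) v* M) f"
      unfolding tvec_partial[OF c] by (simp add: vector_matrix_mult_def sum_distrib_left sum_distrib_right mult_ac)
    finally show ?thesis .
  qed (simp add: ham_field_def tvec_outside)
qed

lemma ham_tangent:
  assumes "y \<in> Cinf A" shows "ham y p \<in> tangent A p"
proof -
  obtain c where c: "c \<in> A" "p \<in> fst c" by (rule chart_at)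
  obtain M where "poisson_matrix_at A P c p M" using poisson_matrix[OF c] by blast
  then show ?thesis using ham_tvec[OF _ c assms] tvec_tangent[OF c] by simp
qed

text \<open>
  The components of \<open>ham y\<close> near a point are its values on local coordinate functions, that is brackets
  of smooth functions.
\<close>

lemma ham_vfield:
  assumes y: "y \<in> Cinf A" shows "ham y \<in> vfields A"
proof -
  have "\<exists>a. smooth_on (snd c ` fst c) a \<and> (\<forall>p\<in>fst c. ham y p = tvec A c p (a (snd c p)))"
    if c: "c \<in> A" for c
  proof -
    let ?a = "\<lambda>z. coords A c (chart_inv c z) (ham y (chart_inv c z))"
    have "smooth_on (snd c ` fst c) ?a"
    proof (rule smooth_on_local[OF open_chart_range[OF c]])
      fix z assume "z \<in> snd c ` fst c"
      then obtain p where p: "p \<in> fst c" "z = snd c p" by blast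
      obtain W and u :: "'n \<Rightarrow> 'a \<Rightarrow> real" where W: "open W" "p \<in> W" "W \<subseteq> fst c"
        and u: "\<And>j. u j \<in> Cinf A" "\<And>q a j. q \<in> W \<Longrightarrow> tvec A c q a (u j) = a $ j"
        by (rule local_coordinates[OF c p(1)], rule that) (assumption | blast)+
      have oW: "open (snd c ` W)" using open_chart_image[OF c W(1,3)] .
      let ?b = "\<lambda>z. \<Sum>j\<in>UNIV. poisson P y (u j) (chart_inv c z) *\<^sub>R axis j (1::real)"
      have "smooth_on (snd c ` fst c) ?b"
        by (intro smooth_on_sum smooth_on_scaleR smooth_on_const open_chart_range[OF c]
            Cinf_smooth[OF poisson_Cinf[OF y u(1)] c])
      then have "smooth_on (snd c ` W) ?b"
        using W(3) by (rule smooth_on_subset[OF _ image_mono])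
      moreover have "?b z = ?a z" if "z \<in> snd c ` W" for z
      proof -
        obtain q where q: "q \<in> W" "z = snd c q" using \<open>z \<in> snd c ` W\<close> by blast
        then have qc: "q \<in> fst c" "chart_inv c z = q" using W(3) c by auto
        have "coords A c q (ham y q) $ j = poisson P y (u j) q" for j
          using u(2)[OF q(1), of "coords A c q (ham y q)" j] tvec_coords[OF c qc(1) ham_tangent[OF y]]
          by (simp add: ham_apply[OF u(1)])
        then show ?thesis
          using basis_expansion[of "coords A c q (ham y q)"] by (simp add: qc(2) scalar_mult_eq_scaleR)
      qed
      ultimately have "smooth_on (snd c ` W) ?a" by (rule smooth_on_cong[OF oW])
      then show "\<exists>T. open T \<and> z \<in> T \<and> smooth_on T ?a" using oW p W(2) by blast
    qed
    moreover have "ham y p = tvec A c p (?a (snd c p))" if "p \<in> fst c" for p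
      using that c tvec_coords[OF c that ham_tangent[OF y]] by simp
    ultimately show ?thesis by blast
  qed
  then show ?thesis unfolding vfields_def using ham_tangent[OF y] by blast
qed

text \<open>
  Nondegeneracy gives the differential that \<open>y\<close> must have at \<open>p\<close>; a linear combination of local
  coordinate functions realises it.
\<close>

lemma ham_surj:
  assumes "v \<in> tangent A p" obtains y where "y \<in> Cinf A" "ham y p = v"
proof -
  obtain c where c: "c \<in> A" "p \<in> fst c" by (rule chart_at)
  obtain M where M: "poisson_matrix_at A P c p M" "invertible M" using poisson_matrix[OF c] by blast
  obtain b where b: "v = tvec A c p b" using assms tangent_eq[OF c] by blast
  obtain W and u :: "'n \<Rightarrow> 'a \<Rightarrow> real" where W: "open W" "p \<in> W" "W \<subseteq> fst c"
    and u: "\<And>j. u j \<in> Cinf A" "\<And>q a j. q \<in> W \<Longrightarrow> tvec A c q a (u j) = a $ j"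
    by (rule local_coordinates[OF c], rule that) (assumption | blast)+
  define d where "d = b v* matrix_inv M"
  define y where "y q = (\<Sum>i\<in>UNIV. d $ i * u i q)" for q
  have y: "y \<in> Cinf A" unfolding y_def by (intro Cinf_sum Cinf_mult Cinf_const u)
  have "partial A c k p y = d $ k" for k
  proof -
    have t: "partial A c k p \<in> tangent A p" using partial_tangent[OF c] .
    have "partial A c k p y = (\<Sum>i\<in>UNIV. d $ i * partial A c k p (u i))"
      unfolding y_def
      by (simp add: tangent_fun_sum[OF t] Cinf_mult Cinf_const u tangent_fun_mult[OF t] tangent_fun_const[OF t])
    also have "\<dots> = d $ k"
      by (simp add: partial_def u(2)[OF W(2)] axis_def if_distrib[of "\<lambda>x. _ * x"] cong: if_cong)
    finally show ?thesis .
  qed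
  then have "(\<chi> i. partial A c i p y) = d" by (simp add: vec_eq_iff)
  then have "ham y p = tvec A c p b"
    unfolding ham_tvec[OF M(1) c y] d_def
    by (simp add: vector_matrix_mul_assoc matrix_inv_left[OF M(2)])
  then show ?thesis using that y b by blast
qed

lemma symplectic_form2: "\<omega> \<in> forms A 2"
  using symplectic by (simp add: symplectic_form_def)

text \<open>
  Contracting \<open>\<omega>\<^sub>i\<^sub>j\<close> with \<open>(ham y)\<^sup>i = \<omega>\<^sup>k\<^sup>i \<partial>\<^sub>k y\<close> gives \<open>\<partial>\<^sub>j y\<close>. The factor 2 arises because
  \<open>\<omega>\<^sub>i\<^sub>j dx\<^sup>i \<and> dx\<^sup>j\<close> is summed over all pairs of indices.
\<close>

lemma omega_ham:
  assumes y: "y \<in> Cinf A" and w: "w \<in> tangent A p"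
  shows "\<omega> p [ham y p, w] = 2 * w y"
proof -
  obtain c where c: "c \<in> A" "p \<in> fst c" by (rule chart_at)
  obtain M where M: "poisson_matrix_at A P c p M" "invertible M" "transpose M = - M"
    using poisson_matrix[OF c] by blast
  obtain a where a: "w = tvec A c p a" using w tangent_eq[OF c] by blast
  define N where "N = matrix_inv M"
  define e where "e = (\<chi> i. partial A c i p y)"
  define b where "b = e v* M"
  have dx: "wedge (dx A c i) (dx A c j) p [tvec A c p b, tvec A c p a] = b $ i * a $ j - a $ i * b $ j" for i j
    using c by (subst wedge_1_1) (auto simp: dx_def tvec_tangent coords_tvec)
  have e: "inner e a = tvec A c p a y"
    by (simp add: tvec_partial[OF c] inner_vec_def e_def mult.commute)
  have MN: "M ** N = mat 1" "N ** M = mat 1"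
    using matrix_inv_left[OF M(2)] matrix_inv_right[OF M(2)] by (simp_all add: N_def)
  have b': "b = - (M *v e)"
  proof -
    have "b = transpose M *v e" by (simp add: b_def)
    then show ?thesis
      unfolding M(3) by (simp add: vec_eq_iff matrix_vector_mult_def sum_negf)
  qed
  have "\<omega> p [tvec A c p b, tvec A c p a] = (\<Sum>i\<in>UNIV. \<Sum>j\<in>UNIV. N $ i $ j * (b $ i * a $ j - a $ i * b $ j))"
    using symplectic c M(1) by (simp add: symplectic_form_def sum_fun_apply smul_def dx flip: N_def)
  also have "\<dots> = inner b (N *v a) - inner a (N *v b)"
    by (simp add: inner_vec_def matrix_vector_mult_def sum_distrib_left algebra_simps sum_subtractf)
  also have "inner b (N *v a) = inner e a"
    unfolding b_def dot_lmul_matrix by (simp add: matrix_vector_mul_assoc MN)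
  also have "inner a (N *v b) = - inner e a"
  proof -
    have "N *v b = - (N *v (M *v e))"
      unfolding b' by (simp add: vec_eq_iff matrix_vector_mult_def sum_negf)
    then show ?thesis by (simp add: matrix_vector_mul_assoc MN inner_commute)
  qed
  finally show ?thesis
    unfolding a using ham_tvec[OF M(1) c y] e by (simp add: b_def e_def)
qed

text \<open>
  Hamiltonian fields of coordinate functions form a local frame, and \<open>\<omega>\<close> yields the coefficients:
  \<open>U = \<Sum>\<^sub>k \<omega>(U, \<partial>/\<partial>x\<^sup>k) / 2 ham(x\<^sup>k)\<close>. At \<open>p\<close> they depend on the value of \<open>U\<close> at \<open>p\<close> only.
\<close>

lemma vfield_decomposition:
  assumes c: "c \<in> A" and p: "p \<in> fst c"
  obtains \<psi> and y :: "'n \<Rightarrow> 'a \<Rightarrow> real" where "\<psi> \<in> Cinf A" "\<psi> p = 1" "\<And>k. y k \<in> Cinf A"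
    "\<And>U. U \<in> vfields A \<Longrightarrow> \<exists>g. (\<forall>k. g k \<in> Cinf A \<and> g k p = \<omega> p [U p, partial A c k p] / 2) \<and>
        smul_vf \<psi> U = (\<Sum>k\<in>UNIV. smul_vf (g k) (ham (y k)))"
proof -
  obtain W and y :: "'n \<Rightarrow> 'a \<Rightarrow> real" and \<psi> where W: "p \<in> W" "W \<subseteq> fst c"
    and y: "\<forall>j. y j \<in> Cinf A" "\<forall>q\<in>W. \<forall>a j. tvec A c q a (y j) = a $ j"
    and \<psi>: "\<psi> \<in> Cinf A" "\<psi> p = 1" "\<forall>v\<in>tangent A p. v \<psi> = 0" "\<forall>q. q \<notin> W \<longrightarrow> \<psi> q = 0"
    and extend: "\<forall>g. smooth_on (snd c ` fst c) g \<longrightarrow> (\<lambda>q. \<psi> q * g (snd c q)) \<in> Cinf A"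
    by (rule cutoff_coordinates[OF c p])
  note y = y[rule_format] and \<psi> = \<psi>[rule_format]
  note \<omega> = symplectic_form2 and S = open_chart_range[OF c]
  have "\<exists>g. (\<forall>k. g k \<in> Cinf A \<and> g k p = \<omega> p [U p, partial A c k p] / 2) \<and>
        smul_vf \<psi> U = (\<Sum>k\<in>UNIV. smul_vf (g k) (ham (y k)))" if U: "U \<in> vfields A" for U
  proof -
    obtain a where a: "smooth_on (snd c ` fst c) a" "\<And>p. p \<in> fst c \<Longrightarrow> U p = tvec A c p (a (snd c p))"
      using vfields_coords[OF U c] by metis
    define g where "g k q = \<psi> q * (1 / 2 * (\<Sum>j\<in>UNIV. a (snd c q) $ j *
        \<omega> (chart_inv c (snd c q)) [partial A c j (chart_inv c (snd c q)), partial A c k (chart_inv c (snd c q))]))"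
      for k q
    have g: "g k \<in> Cinf A" for k
      unfolding g_def using forms_smooth[OF \<omega> c, of "[_, k]"]
      by (intro extend[rule_format] smooth_on_mult smooth_on_const smooth_on_sum S
          smooth_on_bounded_linear[OF bounded_linear_vec_nth] a) simp
    have gq: "g k q = \<psi> q * (\<omega> q [U q, partial A c k q] / 2)" for k q
    proof (cases "q \<in> W")
      case True
      then have q: "q \<in> fst c" using W(2) by blast
      show ?thesis
        using form2_expand_left[OF \<omega> c q partial_tangent[OF c q]] c q by (simp add: g_def a(2)[OF q])
    qed (simp add: g_def \<psi>(4))
    have "smul_vf \<psi> U q = (\<Sum>k\<in>UNIV. smul_vf (g k) (ham (y k))) q" for q
    proof (rule tangent_ext)
      show "smul_vf \<psi> U q \<in> tangent A q"
        using vfields_tangent[OF vfields_smul[OF \<psi>(1) U]] .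
      show "(\<Sum>k\<in>UNIV. smul_vf (g k) (ham (y k))) q \<in> tangent A q"
        by (intro vfields_tangent vfields_sum vfields_smul g ham_vfield y(1))
      fix f assume f: "f \<in> Cinf A"
      show "smul_vf \<psi> U q f = (\<Sum>k\<in>UNIV. smul_vf (g k) (ham (y k))) q f"
      proof (cases "q \<in> W")
        case True
        then have q: "q \<in> fst c" using W(2) by blast
        have Uq: "U q \<in> tangent A q" using vfields_tangent[OF U] .
        obtain b where b: "ham f q = tvec A c q b" using ham_tangent[OF f] tangent_eq[OF c q] by blast
        have bk: "ham (y k) q f = - b $ k" for k
          using y(2)[OF True, of b k] by (simp add: ham_apply f y(1) poisson_antisym[of f] flip: b)
        \<comment> \<open>Test both sides on \<open>f\<close>: the values of \<open>ham (y k)\<close> on \<open>f\<close> are the negated components of \<open>ham f\<close>.\<close>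
        have "2 * U q f = - \<omega> q [U q, ham f q]"
          using omega_ham[OF f Uq] form2_swap[OF \<omega> ham_tangent[OF f] Uq] by simp
        also have "\<dots> = - (\<Sum>k\<in>UNIV. b $ k * \<omega> q [U q, partial A c k q])"
          unfolding b form2_expand_right[OF \<omega> c q Uq] ..
        also have "\<dots> = 2 * (\<Sum>k\<in>UNIV. \<omega> q [U q, partial A c k q] / 2 * ham (y k) q f)"
          by (simp add: bk sum_distrib_left sum_negf mult_ac)
        finally have "U q f = (\<Sum>k\<in>UNIV. \<omega> q [U q, partial A c k q] / 2 * ham (y k) q f)"
          by simp
        then show ?thesis
          unfolding smul_vf_def sum_fun_apply gq by (simp only: sum_distrib_left mult.assoc)
      qed (simp add: smul_vf_def sum_fun_apply gq \<psi>(4))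
    qed
    then have "smul_vf \<psi> U = (\<Sum>k\<in>UNIV. smul_vf (g k) (ham (y k)))" by blast
    then show ?thesis using g gq \<psi>(2) by (intro exI[of _ g]) simp
  qed
  note main = this
  show ?thesis
    by (rule that[of \<psi> y]) (rule \<psi> main y(1) | assumption)+
qed

end

section \<open>The associated connection\<close>

locale associated_symplectic_deformation = symplectic_deformation A P D \<omega>
  for A :: "('a::{t2_space, second_countable_topology}, 'n::finite) chart set"
    and P :: "'a form \<Rightarrow> 'a form \<Rightarrow> 'a form fps"
    and D :: "'a form \<Rightarrow> 'a form fps"
    and \<omega> :: "'a form" +
  fixes nabla :: "'a vfield \<Rightarrow> 'a form \<Rightarrow> 'a form"
  assumes associated: "associated_connection A P nabla"
begin

sublocale connection: covariant_connection A nabla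
  using associated by (simp add: associated_connection_def)

lemma gam_nabla: "y \<in> Cinf A \<Longrightarrow> \<tau> \<in> forms A 1 \<Longrightarrow> gam P y \<tau> = nabla (ham y) \<tau>"
  using associated by (simp add: associated_connection_def)

lemma nabla_zero_vf: "\<tau> \<in> forms A 1 \<Longrightarrow> nabla 0 \<tau> = 0"
  using connection.add_vf[OF vfields_zero vfields_zero] by simp

lemma nabla_zero_form: "U \<in> vfields A \<Longrightarrow> nabla U 0 = 0"
  using connection.add_form[OF _ forms_zero forms_zero] by simp

lemma nabla_sum_vf:
  assumes "\<tau> \<in> forms A 1" "\<And>k. k \<in> I \<Longrightarrow> F k \<in> vfields A"
  shows "nabla (\<Sum>k\<in>I. F k) \<tau> = (\<Sum>k\<in>I. nabla (F k) \<tau>)"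
  using assms(2)
proof (induction I rule: infinite_finite_induct)
  case (insert k I)
  have "nabla (F k + (\<Sum>k\<in>I. F k)) \<tau> = nabla (F k) \<tau> + nabla (\<Sum>k\<in>I. F k) \<tau>"
    by (rule connection.add_vf) (use insert.prems assms(1) vfields_sum[of I F] in blast)+
  then show ?case
    using insert by (simp only: sum.insert[OF insert.hyps]) simp
qed (simp_all add: nabla_zero_vf[OF assms(1)])

text \<open>
  Tensoriality in the direction: a cutoff multiple of \<open>U\<close> is a combination of fixed fields, with
  coefficients whose values at \<open>p\<close> are determined by \<open>U p\<close>.
\<close>

lemma nabla_pointwise:
  assumes U: "U \<in> vfields A" and V: "V \<in> vfields A" and eq: "U p = V p" and \<tau>: "\<tau> \<in> forms A 1"
  shows "nabla U \<tau> p = nabla V \<tau> p"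
proof -
  obtain c where c: "c \<in> A" "p \<in> fst c" by (rule chart_at)
  show ?thesis
  proof (rule vfield_decomposition[OF c])
    fix \<psi> and y :: "'n \<Rightarrow> 'a \<Rightarrow> real" assume \<psi>: "\<psi> \<in> Cinf A" "\<psi> p = 1" and y: "\<And>k. y k \<in> Cinf A"
      and dec: "\<And>U. U \<in> vfields A \<Longrightarrow> \<exists>g. (\<forall>k. g k \<in> Cinf A \<and> g k p = \<omega> p [U p, partial A c k p] / 2) \<and>
          smul_vf \<psi> U = (\<Sum>k\<in>UNIV. smul_vf (g k) (ham (y k)))"
    have "nabla U \<tau> p vs = (\<Sum>k\<in>UNIV. \<omega> p [U p, partial A c k p] / 2 * nabla (ham (y k)) \<tau> p vs)"
      if U: "U \<in> vfields A" for U vs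
    proof -
      obtain g where g: "\<And>k. g k \<in> Cinf A" "\<And>k. g k p = \<omega> p [U p, partial A c k p] / 2"
        "smul_vf \<psi> U = (\<Sum>k\<in>UNIV. smul_vf (g k) (ham (y k)))"
        using dec[OF U] by blast
      have "nabla U \<tau> p vs = nabla (smul_vf \<psi> U) \<tau> p vs"
        unfolding connection.smul_vf[OF \<psi>(1) U \<tau>] by (simp add: smul_def \<psi>(2))
      also have "nabla (smul_vf \<psi> U) \<tau> = (\<Sum>k\<in>UNIV. smul (g k) (nabla (ham (y k)) \<tau>))"
        unfolding g(3) by (simp only: nabla_sum_vf[OF \<tau> vfields_smul[OF g(1) ham_vfield[OF y]]]
            connection.smul_vf[OF g(1) ham_vfield[OF y] \<tau>])
      finally show ?thesis
        by (simp add: sum_fun_apply smul_def g(2))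
    qed
    then show "nabla U \<tau> p = nabla V \<tau> p" using U V eq by (intro ext) simp
  qed
qed

text \<open>
  The expression \<open>U(\<tau>(V)) - (\<nabla>\<^sub>U \<tau>)(V)\<close> is linear over functions in \<open>\<tau>\<close>, because the derivatives of a
  coefficient cancel. Hence at \<open>p\<close> it is the pairing of \<open>\<tau>\<close> with a tangent vector, whose values on
  functions are obtained for \<open>\<tau> = df\<close>; this identifies it with \<open>nabla_vf\<close>.
\<close>

lemma
  assumes U: "U \<in> vfields A" and V: "V \<in> vfields A"
  shows nabla_vf_tangent: "nabla_vf A nabla U V p \<in> tangent A p"
    and form_nabla_vf: "\<tau> \<in> forms A 1 \<Longrightarrow>
      \<tau> p [nabla_vf A nabla U V p] = U p (\<lambda>q. \<tau> q [V q]) - nabla U \<tau> p [V p]"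
proof -
  obtain c where c: "c \<in> A" "p \<in> fst c" by (rule chart_at)
  have Up: "U p \<in> tangent A p" using vfields_tangent[OF U] .
  define L where "L \<tau> = U p (\<lambda>q. \<tau> q [V q]) - nabla U \<tau> p [V p]" for \<tau>
  have L_add: "L (\<tau> + \<eta>) = L \<tau> + L \<eta>" if "\<tau> \<in> forms A 1" "\<eta> \<in> forms A 1" for \<tau> \<eta>
    using tangent_fun_add[OF Up form1_eval_Cinf[OF that(1) V] form1_eval_Cinf[OF that(2) V]]
    by (simp add: L_def connection.add_form[OF U that])
  have L_zero: "L 0 = 0"
    using tangent_fun_const[OF Up, of 0] by (simp add: L_def nabla_zero_form[OF U])
  have L_smul: "L (smul f \<tau>) = f p * L \<tau>" if "f \<in> Cinf A" "\<tau> \<in> forms A 1" for f \<tau>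
    using tangent_fun_mult[OF Up that(1) form1_eval_Cinf[OF that(2) V]]
    unfolding L_def connection.leibniz[OF that(1) U that(2)] by (simp add: smul_def algebra_simps)
  have L_sum: "L (\<Sum>j\<in>I. F j) = (\<Sum>j\<in>I. L (F j))" if F: "\<And>j. F j \<in> forms A 1" for F and I :: "'n set"
  proof (induction I rule: infinite_finite_induct)
    case (insert j I)
    then show ?case
      using L_add[OF F forms_sum[of I F]] F by (simp only: sum.insert[OF insert.hyps])
  next
    case empty
    show ?case by (simp only: sum.empty L_zero)
  qed simp
  have "\<exists>b. \<forall>\<tau>\<in>forms A 1. L \<tau> = \<tau> p [tvec A c p b]"
  proof (rule form1_decomposition[OF c])
    fix \<psi> and y :: "'n \<Rightarrow> 'a \<Rightarrow> real"
    assume \<psi>: "\<psi> \<in> Cinf A" "\<psi> p = 1" and y: "\<And>j. y j \<in> Cinf A"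
      and dec: "\<And>\<tau>. \<tau> \<in> forms A 1 \<Longrightarrow> \<exists>g. (\<forall>j. g j \<in> Cinf A \<and> g j p = \<tau> p [partial A c j p]) \<and>
        smul \<psi> \<tau> = (\<Sum>j\<in>UNIV. smul (g j) (ext_d A (fn (y j))))"
    define b where "b = (\<chi> j. L (ext_d A (fn (y j))))"
    have "L \<tau> = \<tau> p [tvec A c p b]" if \<tau>: "\<tau> \<in> forms A 1" for \<tau>
    proof -
      obtain g where g: "\<And>j. g j \<in> Cinf A" "\<And>j. g j p = \<tau> p [partial A c j p]"
        "smul \<psi> \<tau> = (\<Sum>j\<in>UNIV. smul (g j) (ext_d A (fn (y j))))"
        using dec[OF \<tau>] by blast
      have "L \<tau> = L (smul \<psi> \<tau>)" by (simp add: L_smul[OF \<psi>(1) \<tau>] \<psi>(2))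
      also have "\<dots> = (\<Sum>j\<in>UNIV. g j p * L (ext_d A (fn (y j))))"
        unfolding g(3) by (simp only: L_sum[OF forms_smul[OF g(1) d_fn_form[OF y]]] L_smul[OF g(1) d_fn_form[OF y]])
      also have "\<dots> = \<tau> p [tvec A c p b]"
        by (simp add: form1_expand[OF \<tau> c] g(2) b_def mult.commute)
      finally show ?thesis .
    qed
    then show ?thesis by blast
  qed
  then obtain b where L: "\<And>\<tau>. \<tau> \<in> forms A 1 \<Longrightarrow> L \<tau> = \<tau> p [tvec A c p b]" by blast
  have "nabla_vf A nabla U V p f = tvec A c p b f" for f
  proof (cases "f \<in> Cinf A")
    case True
    have "nabla_vf A nabla U V p f = L (ext_d A (fn f))"
      using True by (simp add: nabla_vf_def L_def ext_d_fn[OF True vfields_tangent[OF V]])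
    then show ?thesis
      using L[OF d_fn_form[OF True]] ext_d_fn[OF True tvec_tangent[OF c]] by simp
  qed (simp add: nabla_vf_def tvec_outside)
  then have X: "nabla_vf A nabla U V p = tvec A c p b" by blast
  show "nabla_vf A nabla U V p \<in> tangent A p"
    unfolding X by (rule tvec_tangent[OF c])
  show "\<tau> p [nabla_vf A nabla U V p] = U p (\<lambda>q. \<tau> q [V q]) - nabla U \<tau> p [V p]" if "\<tau> \<in> forms A 1"
    using L[OF that] by (simp add: X L_def)
qed

lemma nabla_2form_add:
  assumes "U \<in> vfields A" "V \<in> vfields A" "W \<in> vfields A" "\<alpha> \<in> forms A 2" "\<beta> \<in> forms A 2"
  shows "nabla_2form A nabla U (\<alpha> + \<beta>) V W p =
    nabla_2form A nabla U \<alpha> V W p + nabla_2form A nabla U \<beta> V W p"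
  using tangent_fun_add[OF vfields_tangent[OF assms(1)] form2_eval_Cinf[OF assms(4,2,3)]
      form2_eval_Cinf[OF assms(5,2,3)]]
  by (simp add: nabla_2form_def)

lemma nabla_2form_smul:
  assumes "U \<in> vfields A" "V \<in> vfields A" "W \<in> vfields A" "f \<in> Cinf A" "\<alpha> \<in> forms A 2"
  shows "nabla_2form A nabla U (smul f \<alpha>) V W p =
    U p f * \<alpha> p [V p, W p] + f p * nabla_2form A nabla U \<alpha> V W p"
  using tangent_fun_mult[OF vfields_tangent[OF assms(1)] assms(4) form2_eval_Cinf[OF assms(5,2,3)]]
  by (simp add: nabla_2form_def smul_def algebra_simps)

lemma nabla_2form_wedge:
  assumes U: "U \<in> vfields A" and V: "V \<in> vfields A" and W: "W \<in> vfields A"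
    and \<tau>: "\<tau> \<in> forms A 1" and \<eta>: "\<eta> \<in> forms A 1"
  shows "nabla_2form A nabla U (wedge \<tau> \<eta>) V W p =
    (wedge (nabla U \<tau>) \<eta> + wedge \<tau> (nabla U \<eta>)) p [V p, W p]"
proof -
  have w: "wedge \<sigma> \<rho> q [u, v] = \<sigma> q [u] * \<rho> q [v] - \<sigma> q [v] * \<rho> q [u]"
    if "\<sigma> \<in> forms A 1" "\<rho> \<in> forms A 1" for \<sigma> \<rho> q u v
    using forms_outside[OF that(1), of "[]"] forms_outside[OF that(2), of "[]"] by (simp add: wedge_1_1)
  note C = form1_eval_Cinf[OF \<tau> V] form1_eval_Cinf[OF \<tau> W] form1_eval_Cinf[OF \<eta> V] form1_eval_Cinf[OF \<eta> W]
  note Up = vfields_tangent[OF U, of p]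
  have "U p (\<lambda>q. \<tau> q [V q] * \<eta> q [W q] - \<tau> q [W q] * \<eta> q [V q]) =
      \<tau> p [V p] * U p (\<lambda>q. \<eta> q [W q]) + U p (\<lambda>q. \<tau> q [V q]) * \<eta> p [W p] -
      (\<tau> p [W p] * U p (\<lambda>q. \<eta> q [V q]) + U p (\<lambda>q. \<tau> q [W q]) * \<eta> p [V p])"
    by (simp only: tangent_fun_diff[OF Up Cinf_mult[OF C(1,4)] Cinf_mult[OF C(2,3)]]
        tangent_fun_mult[OF Up C(1,4)] tangent_fun_mult[OF Up C(2,3)])
  then show ?thesis
    by (simp add: nabla_2form_def w[OF \<tau> \<eta>] w[OF connection.form[OF U \<tau>] \<eta>] w[OF \<tau> connection.form[OF U \<eta>]]
        form_nabla_vf[OF U V] form_nabla_vf[OF U W] \<tau>[simplified] \<eta>[simplified] algebra_simps)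
qed

text \<open>
  The difference of both sides is additive in \<open>\<alpha>\<close> and, at \<open>p\<close>, unchanged by a factor that equals 1
  near \<open>p\<close>, because both sides satisfy the same Leibniz rule over functions. It vanishes on wedge
  products of \<open>1\<close>-forms, hence on all \<open>2\<close>-forms.
\<close>

lemma gam_nabla_2form:
  assumes x: "x \<in> Cinf A" and V: "V \<in> vfields A" and W: "W \<in> vfields A" and \<alpha>: "\<alpha> \<in> forms A 2"
  shows "gam P x \<alpha> p [V p, W p] = nabla_2form A nabla (ham x) \<alpha> V W p"
proof -
  note U = ham_vfield[OF x]
  define E where "E \<alpha> = gam P x \<alpha> p [V p, W p] - nabla_2form A nabla (ham x) \<alpha> V W p" for \<alpha>
  have E_add: "E (\<alpha> + \<beta>) = E \<alpha> + E \<beta>" if "\<alpha> \<in> forms A 2" "\<beta> \<in> forms A 2" for \<alpha> \<beta>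
    by (simp add: E_def gam_add[OF x that] nabla_2form_add[OF U V W that])
  have E_wedge: "E (wedge \<tau> \<eta>) = 0" if "\<tau> \<in> forms A 1" "\<eta> \<in> forms A 1" for \<tau> \<eta>
    unfolding E_def nabla_2form_wedge[OF U V W that] gam_wedge[OF x that]
    by (simp only: gam_nabla[OF x] that diff_self)
  have "E \<alpha> = 0"
  proof (rule form2_decomposition[OF \<alpha>])
    fix \<psi> and \<tau> \<sigma> :: "'n \<Rightarrow> 'a form" assume \<psi>: "\<psi> \<in> Cinf A" "\<psi> p = 1"
        "\<And>v. v \<in> tangent A p \<Longrightarrow> v \<psi> = 0" and f: "\<And>j. \<tau> j \<in> forms A 1" "\<And>j. \<sigma> j \<in> forms A 1"
      and dec: "smul \<psi> \<alpha> = (\<Sum>j\<in>UNIV. wedge (\<tau> j) (\<sigma> j))"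
    have w: "wedge (\<tau> j) (\<sigma> j) \<in> forms A 2" for j
      using wedge_form[OF f] by (simp add: numeral_2_eq_2)
    have E_zero: "E 0 = 0"
      using E_add[OF forms_zero forms_zero] by simp
    have "E (\<Sum>j\<in>I. wedge (\<tau> j) (\<sigma> j)) = 0" for I
    proof (induction I rule: infinite_finite_induct)
      case (insert j I)
      then show ?case
        using E_add[OF w forms_sum[of I]] w by (simp only: sum.insert[OF insert.hyps] E_wedge[OF f])
    next
      case empty
      show ?case by (simp only: sum.empty E_zero)
    qed simp
    then have "E (smul \<psi> \<alpha>) = 0" by (simp add: dec)
    moreover have "E (smul \<psi> \<alpha>) = E \<alpha>"
      using \<psi>(3)[OF ham_tangent[OF x]]
      by (simp add: E_def gam_smul[OF x \<psi>(1) \<alpha>] nabla_2form_smul[OF U V W \<psi>(1) \<alpha>])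
        (simp add: smul_def \<psi>(2) flip: ham_apply[OF \<psi>(1)])
    ultimately show "E \<alpha> = 0" by simp
  qed
  then show ?thesis by (simp add: E_def)
qed

lemma nabla_2form_pointwise:
  assumes "U \<in> vfields A" "U' \<in> vfields A" "U p = U' p"
  shows "nabla_2form A nabla U \<alpha> V W p = nabla_2form A nabla U' \<alpha> V W p"
proof -
  have "nabla_vf A nabla U X p = nabla_vf A nabla U' X p" for X
    using nabla_pointwise[OF assms d_fn_form] assms(3) by (auto simp: nabla_vf_def)
  then show ?thesis by (simp add: nabla_2form_def assms(3))
qed

lemma preserves_iff_gam: "preserves_2form A nabla \<omega> \<longleftrightarrow> (\<forall>x\<in>Cinf A. gam P x \<omega> = 0)"
proof
  assume pres: "preserves_2form A nabla \<omega>"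
  show "\<forall>x\<in>Cinf A. gam P x \<omega> = 0"
  proof
    fix x assume x: "x \<in> Cinf A"
    show "gam P x \<omega> = 0"
    proof (rule form2_ext[OF gam_form[OF x symplectic_form2] forms_zero])
      fix p v w assume "v \<in> tangent A p" "w \<in> tangent A p"
      then obtain y z where y: "y \<in> Cinf A" "v = ham y p" and z: "z \<in> Cinf A" "w = ham z p"
        using ham_surj by metis
      show "gam P x \<omega> p [v, w] = 0 p [v, w]"
        using pres gam_nabla_2form[OF x ham_vfield[OF y(1)] ham_vfield[OF z(1)] symplectic_form2, of p]
        by (simp add: preserves_2form_def ham_vfield x y z)
    qed
  qed
next
  assume C: "\<forall>x\<in>Cinf A. gam P x \<omega> = 0"
  have "nabla_2form A nabla U \<omega> V W p = 0" if UVW: "U \<in> vfields A" "V \<in> vfields A" "W \<in> vfields A" for U V W p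
  proof -
    obtain x where x: "x \<in> Cinf A" "ham x p = U p"
      using ham_surj[OF vfields_tangent[OF UVW(1)]] by metis
    show ?thesis
      using nabla_2form_pointwise[OF UVW(1) ham_vfield[OF x(1)]] C x
        gam_nabla_2form[OF x(1) UVW(2,3) symplectic_form2, of p] by simp
  qed
  then show "preserves_2form A nabla \<omega>"
    unfolding preserves_2form_def by (auto simp: fun_eq_iff)
qed

section \<open>Torsion\<close>

text \<open>
  The covariant Hessian of \<open>y\<close>, evaluated on the Hamiltonian vectors of \<open>x\<close> and \<open>z\<close>.
\<close>

definition hess where "hess x y z p = nabla (ham x) (ext_d A (fn y)) p [ham z p]"

lemma hess_antisym:
  assumes "x \<in> Cinf A" "y \<in> Cinf A" "z \<in> Cinf A"
  shows "hess x y z p - hess y x z p = poisson P z (poisson P x y) p"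
proof -
  have "poisson P z (poisson P x y) p = ext_d A (fn (poisson P x y)) p [ham z p]"
    using ext_d_fn[OF poisson_Cinf[OF assms(1,2)] ham_tangent[OF assms(3)]]
    by (simp add: ham_apply[OF poisson_Cinf[OF assms(1,2)]])
  also have "\<dots> = hess x y z p - hess y x z p"
    unfolding d_poisson[OF assms(1,2)] gam_nabla[OF assms(1) d_fn_form[OF assms(2)]]
      gam_nabla[OF assms(2) d_fn_form[OF assms(1)]] by (simp add: hess_def)
  finally show ?thesis ..
qed

text \<open>
  The second derivatives in the two dual connections are the two terms of the Lie bracket.
\<close>

lemma torsion_apply:
  assumes "f \<in> Cinf A"
  shows "torsion A nabla U V p f =
    nabla V (ext_d A (fn f)) p [U p] - nabla U (ext_d A (fn f)) p [V p]"
  using assms by (simp add: torsion_def nabla_vf_def lie_bracket_def)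

lemma torsion_ham:
  assumes "z \<in> Cinf A" shows "torsion A nabla (ham x) (ham y) p z = hess y z x p - hess x z y p"
  by (simp add: torsion_apply[OF assms] hess_def)

lemma torsion_free_iff:
  "torsion_free A nabla \<longleftrightarrow>
    (\<forall>x\<in>Cinf A. \<forall>y\<in>Cinf A. \<forall>z\<in>Cinf A. \<forall>p. torsion A nabla (ham x) (ham y) p z = 0)"
proof
  assume "torsion_free A nabla"
  then show "\<forall>x\<in>Cinf A. \<forall>y\<in>Cinf A. \<forall>z\<in>Cinf A. \<forall>p. torsion A nabla (ham x) (ham y) p z = 0"
    by (simp add: torsion_free_def ham_vfield)
next
  assume T: "\<forall>x\<in>Cinf A. \<forall>y\<in>Cinf A. \<forall>z\<in>Cinf A. \<forall>p. torsion A nabla (ham x) (ham y) p z = 0"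
  have "torsion A nabla U V p f = 0" if U: "U \<in> vfields A" and V: "V \<in> vfields A" for U V p f
  proof (cases "f \<in> Cinf A")
    case True
    obtain x where x: "x \<in> Cinf A" "ham x p = U p" using ham_surj[OF vfields_tangent[OF U]] by metis
    obtain y where y: "y \<in> Cinf A" "ham y p = V p" using ham_surj[OF vfields_tangent[OF V]] by metis
    show ?thesis
    proof -
      have "torsion A nabla U V p f = torsion A nabla (ham x) (ham y) p f"
        by (simp only: torsion_apply[OF True] x(2) y(2)
            nabla_pointwise[OF U ham_vfield[OF x(1)] x(2)[symmetric] d_fn_form[OF True]]
            nabla_pointwise[OF V ham_vfield[OF y(1)] y(2)[symmetric] d_fn_form[OF True]])
      then show ?thesis using T x(1) y(1) True by simp
    qed
  next
    case False
    then have "apply_vf U f = (\<lambda>_. 0)" "apply_vf V f = (\<lambda>_. 0)"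
      using tangent_outside vfields_tangent U V by blast+
    then show ?thesis
      using False tangent_fun_const[OF vfields_tangent[OF U]] tangent_fun_const[OF vfields_tangent[OF V]]
      by (simp add: torsion_def nabla_vf_def lie_bracket_def)
  qed
  then show "torsion_free A nabla"
    unfolding torsion_free_def by (auto simp: fun_eq_iff)
qed

lemma omega_ham_ham:
  assumes "y \<in> Cinf A" "z \<in> Cinf A" shows "\<omega> q [ham y q, ham z q] = 2 * poisson P z y q"
  by (simp add: omega_ham assms ham_tangent ham_apply)

text \<open>
  Through \<open>\<omega>(ham y, v) = 2 v(y)\<close> the left-hand side becomes twice
  \<open>{x,{y,z}} + hess x y z - hess x z y\<close>. Replacing the iterated bracket by Hessians produces the two
  torsion terms.
\<close>

lemma nabla_omega_torsion:
  assumes x: "x \<in> Cinf A" and y: "y \<in> Cinf A" and z: "z \<in> Cinf A"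
  shows "nabla_2form A nabla (ham x) \<omega> (ham y) (ham z) p =
    2 * (torsion A nabla (ham x) (ham y) p z - torsion A nabla (ham x) (ham z) p y)"
proof -
  let ?X = "\<lambda>y. nabla_vf A nabla (ham x) (ham y) p"
  have X: "?X u v = poisson P x (poisson P u v) p - hess x v u p" if "u \<in> Cinf A" "v \<in> Cinf A" for u v
    using that x by (simp add: nabla_vf_def hess_def ham_apply poisson_Cinf)
  have X_tangent: "?X u \<in> tangent A p" if "u \<in> Cinf A" for u
    by (intro nabla_vf_tangent ham_vfield x that)
  have 1: "ham x p (\<lambda>q. \<omega> q [ham y q, ham z q]) = 2 * poisson P x (poisson P z y) p"
    using tangent_fun_mult[OF ham_tangent[OF x] Cinf_const poisson_Cinf[OF z y], of p 2]
      tangent_fun_const[OF ham_tangent[OF x]]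
    by (simp add: omega_ham_ham[OF y z] ham_apply[OF poisson_Cinf[OF z y]])
  have 2: "\<omega> p [?X y, ham z p] = - 2 * ?X y z"
    using form2_swap[OF symplectic_form2 ham_tangent[OF z] X_tangent[OF y]] omega_ham[OF z X_tangent[OF y]]
    by simp
  have 3: "\<omega> p [ham y p, ?X z] = 2 * ?X z y"
    using omega_ham[OF y X_tangent[OF z]] .
  show ?thesis
    unfolding nabla_2form_def 1 2 3 X[OF y z] X[OF z y] torsion_ham[OF z] torsion_ham[OF y]
    using hess_antisym[OF y z x, of p] by simp
qed

text \<open>
  If \<open>\<nabla>\<omega> = 0\<close>, then \<open>T x y z\<close> is symmetric in the last two and antisymmetric in the first two
  arguments, and going around a hexagon of transpositions gives \<open>T x y z = - T x y z\<close>.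
\<close>

lemma central_iff_torsion_free:
  "(\<forall>x\<in>Cinf A. gam P x \<omega> = 0) \<longleftrightarrow> torsion_free A nabla"
proof -
  let ?T = "\<lambda>x y z p. torsion A nabla (ham x) (ham y) p z"
  have "torsion_free A nabla" if pres: "preserves_2form A nabla \<omega>"
    unfolding torsion_free_iff
  proof (intro ballI allI)
    fix x y z p assume c: "x \<in> Cinf A" "y \<in> Cinf A" "z \<in> Cinf A"
    have sym: "?T x y z p = ?T x z y p" if "x \<in> Cinf A" "y \<in> Cinf A" "z \<in> Cinf A" for x y z
      using nabla_omega_torsion[OF that, of p] pres that
      by (simp add: preserves_2form_def ham_vfield)
    have anti: "?T x y z p = - ?T y x z p" if "z \<in> Cinf A" for x y z
      using that by (simp add: torsion_ham)
    show "?T x y z p = 0"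
      using sym[OF c] sym[OF c(2,3,1)] sym[OF c(3,1,2)] anti[of z x y] anti[of y x z] anti[of x y z] c by simp
  qed
  moreover have "gam P x \<omega> = 0" if tf: "torsion_free A nabla" and x: "x \<in> Cinf A" for x
  proof (rule form2_ext[OF gam_form[OF x symplectic_form2] forms_zero])
    fix p v w assume "v \<in> tangent A p" "w \<in> tangent A p"
    then obtain y z where y: "y \<in> Cinf A" "v = ham y p" and z: "z \<in> Cinf A" "w = ham z p"
      using ham_surj by metis
    show "gam P x \<omega> p [v, w] = 0 p [v, w]"
      using gam_nabla_2form[OF x ham_vfield[OF y(1)] ham_vfield[OF z(1)] symplectic_form2, of p] tf
        nabla_omega_torsion[OF x y(1) z(1), of p] x y z
      by (simp add: torsion_free_iff)
  qed
  ultimately show ?thesis using preserves_iff_gam by blast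
qed

end

theorem proposition3p3:
  fixes A :: "('a::{t2_space, second_countable_topology}, 'n::finite) chart set"
    and P :: "'a form \<Rightarrow> 'a form \<Rightarrow> 'a form fps"
    and D :: "'a form \<Rightarrow> 'a form fps"
    and nabla :: "'a vfield \<Rightarrow> 'a form \<Rightarrow> 'a form"
    and \<omega> :: "'a form"
  assumes "smooth_atlas A"
    and "formal_deformation A P D"
    and "nondegenerate_poisson A P"
    and "symplectic_form A P \<omega>"
    and "associated_connection A P nabla"
  shows "(\<forall>x\<in>Cinf A. bigO_h 2 (P (fn x) \<omega> - P \<omega> (fn x))) \<longleftrightarrow>
         preserves_2form A nabla \<omega> \<and> torsion_free A nabla"
proof -
  interpret associated_symplectic_deformation A P D \<omega> nabla
    using assms by (simp add: associated_symplectic_deformation_def symplectic_deformation_def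
        deformed_manifold_def smooth_manifold_def symplectic_deformation_axioms_def
        associated_symplectic_deformation_axioms_def)
  show ?thesis
    using commutator_bigO[OF _ symplectic_form2] central_iff_torsion_free preserves_iff_gam by blast
qed

end
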